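(* Let $K$ be a field with $\mathrm{char}(K)\neq 2,3$, let $\overline{K}$ be an algebraic closure of $K$, and let $n$ be a positive integer with $\gcd(\mathrm{char}(K),n)=1$. Let $E$ be the elliptic curve over $K$ given by $y^2=x^3+ax+b$ with $a,b\in K$, and let $Q=(x_Q,y_Q)\in E$ be a point with $Q\neq\mathcal{O}$ (the point at infinity). Set $$\Lambda=\{P=(x_P,y_P)\in E(\overline{K})\mid nP=Q\}.$$ Then $$\frac{1}{n^2}\sum_{P\in\Lambda}x_P=x_Q\qquad\text{and}\qquad \frac{1}{n^2}\sum_{P\in\Lambda}y_P=n\,y_Q.$$
   Context: $nP$ denotes $P+P+\cdots+P$ ($n$ summands) in the group law of $E$ with identity $\mathcal{O}$. When $\mathrm{char}(K)=0$ the condition $\gcd(\mathrm{char}(K),n)=1$ is vacuous. *)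

theory Defs
  imports "HOL-Algebra.Algebraic_Closure_Type"
begin

datatype 'f point = Infinity | Affine (x_coord: 'f) (y_coord: 'f)

definition on_curve :: "'f::field \<Rightarrow> 'f \<Rightarrow> 'f point \<Rightarrow> bool" where
  "on_curve a b P = (case P of Infinity \<Rightarrow> True | Affine x y \<Rightarrow> y\<^sup>2 = x ^ 3 + a * x + b)"

text \<open>
  The chord-tangent law. The coefficient \<open>b\<close> does not enter the formulas. For two points of the
  curve with the same first coordinate, \<open>y2 = y1\<close> or \<open>y2 = - y1\<close>, so the tangent slope is only used
  for doubling a point with \<open>y1 \<noteq> 0\<close>.
\<close>

fun point_add :: "'f::field \<Rightarrow> 'f point \<Rightarrow> 'f point \<Rightarrow> 'f point" where
  "point_add a Infinity Q = Q"
| "point_add a P Infinity = P"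
| "point_add a (Affine x1 y1) (Affine x2 y2) =
     (if x1 = x2 \<and> y2 = - y1 then Infinity
      else let s = (if x1 = x2 then (3 * x1\<^sup>2 + a) / (2 * y1) else (y2 - y1) / (x2 - x1));
               x3 = s\<^sup>2 - x1 - x2
           in Affine x3 (s * (x1 - x3) - y1))"

text \<open>
  The group of points of \<open>y\<^sup>2 = x\<^sup>3 + a x + b\<close> over the field \<open>'f\<close>. The record notation is
  multiplicative, so the multiple \<open>n P\<close> of a point is written as the power \<open>P [^] n\<close>.
\<close>

definition curve_group :: "'f::field \<Rightarrow> 'f \<Rightarrow> 'f point monoid" where
  "curve_group a b =
     \<lparr>carrier = {P. on_curve a b P}, monoid.mult = point_add a, one = Infinity\<rparr>"

end

theory Submission
  imports Defs
begin

text \<open>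
  Write \<open>x(nP) = A / B\<close> with polynomials \<open>A, B\<close> in \<open>x = x(P)\<close>. Since \<open>x(M + P)\<close> and \<open>x(M - P)\<close> are the
  two roots of a quadratic polynomial whose coefficients are polynomials in \<open>x(M)\<close> and \<open>x(P)\<close>, the
  pairs \<open>(A, B)\<close> satisfy a three-term recurrence in \<open>n\<close>, which only needs the cancellation law
  \<open>(M + P) - P = M\<close> and not the associativity of the group law. It shows that \<open>A\<close> and \<open>B\<close> have no common
  root and that \<open>A = x^(n\<^sup>2) + 0 x^(n\<^sup>2 - 1) + \<dots>\<close>, \<open>B = n\<^sup>2 x^(n\<^sup>2 - 1) + \<dots>\<close>. The same recurrence gives the
  invariance of the differential \<open>dx / y\<close>, that is \<open>n y(nP) = y (A / B)'\<close>.

  The points with \<open>nP = \<plusminus>Q\<close> lie over the roots of \<open>G = A - x\<^sub>Q B\<close>. If \<open>y\<^sub>Q \<noteq> 0\<close>, the differential equation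
  shows that the roots \<open>r\<close> of \<open>G\<close> are simple and that \<open>nP = Q\<close> for the point over \<open>r\<close> with
  \<open>y(P) = n y\<^sub>Q B(r) / G'(r)\<close>; the sum of the \<open>r\<close> is read off in \<open>G\<close>, and the sum of the \<open>B(r) / G'(r)\<close> is the
  coefficient \<open>n\<^sup>2\<close> of \<open>B\<close>. If \<open>y\<^sub>Q = 0\<close>, the preimages are symmetric under \<open>y \<mapsto> - y\<close> and the
  multiplicity of \<open>r\<close> is the number of points over \<open>r\<close>.
\<close>

section \<open>The chord-tangent law\<close>

fun point_neg :: "'f::field point \<Rightarrow> 'f point" where
  "point_neg Infinity = Infinity"
| "point_neg (Affine x y) = Affine x (- y)"

text \<open>\<open>(u : v)\<close> are homogeneous coordinates of \<open>x(P)\<close> on the projective line.\<close>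

fun has_x_ratio :: "'f::field point \<Rightarrow> 'f \<Rightarrow> 'f \<Rightarrow> bool" where
  "has_x_ratio Infinity u v \<longleftrightarrow> u \<noteq> 0 \<and> v = 0"
| "has_x_ratio (Affine x y) u v \<longleftrightarrow> v \<noteq> 0 \<and> u = x * v"

lemma has_x_ratio_nonzero: "has_x_ratio M u v \<Longrightarrow> u \<noteq> 0 \<or> v \<noteq> 0"
  by (cases M) auto

lemma has_x_ratio_exists: "\<exists>u v. has_x_ratio M u v"
  by (cases M) (auto intro: exI[of _ 1])

lemma has_x_ratio_scale: "has_x_ratio M u v \<Longrightarrow> c \<noteq> 0 \<Longrightarrow> has_x_ratio M (c * u) (c * v)"
  by (cases M) auto

locale weierstrass =
  fixes a b :: "'f::field"
  assumes two_neq_0: "(2::'f) \<noteq> 0"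
    and disc_neq_0: "4 * a ^ 3 + 27 * b\<^sup>2 \<noteq> 0"
begin

abbreviation cubic :: "'f \<Rightarrow> 'f" where "cubic x \<equiv> x ^ 3 + a * x + b"

abbreviation add (infixl "\<boxplus>" 65) where "P \<boxplus> Q \<equiv> point_add a P Q"

lemma on_curve_simps [simp]:
  "on_curve a b Infinity" "on_curve a b (Affine x y) \<longleftrightarrow> y\<^sup>2 = cubic x"
  by (auto simp: on_curve_def)

lemma neg_eq_self_iff: "- y = y \<longleftrightarrow> y = 0" for y :: 'f
proof
  assume "- y = y"
  then have "2 * y = 0" by (metis add.right_inverse mult_2)
  then show "y = 0" using two_neq_0 by simp
qed simp

lemma four_neq_0: "(4::'f) \<noteq> 0"
  using two_neq_0 by (metis mult_eq_0_iff numeral_Bit0 mult_2)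

text \<open>The discriminant is a combination of the cubic and its derivative, so the two have no
  common zero.\<close>

lemma smooth: "cubic x = 0 \<Longrightarrow> 3 * x\<^sup>2 + a \<noteq> 0"
proof
  assume "cubic x = 0" "3 * x\<^sup>2 + a = 0"
  then have "4 * a ^ 3 + 27 * b\<^sup>2 = 0" by Groebner_Basis.algebra
  then show False using disc_neq_0 by simp
qed

lemma same_x: "on_curve a b (Affine x y) \<Longrightarrow> on_curve a b (Affine x z) \<Longrightarrow> z = y \<or> z = - y"
  by (simp flip: power2_eq_iff)

lemma add_Infinity_right [simp]: "P \<boxplus> Infinity = P"
  by (cases P) auto

lemma add_chord:
  assumes "x1 \<noteq> x2" "s * (x2 - x1) = y2 - y1"
  shows "Affine x1 y1 \<boxplus> Affine x2 y2 = Affine (s\<^sup>2 - x1 - x2) (s * (x1 - (s\<^sup>2 - x1 - x2)) - y1)"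
proof -
  have "(y2 - y1) / (x2 - x1) = s" using assms by (simp add: field_simps)
  with assms show ?thesis by (simp add: Let_def)
qed

lemma add_tangent:
  assumes "y \<noteq> 0" "s * (2 * y) = 3 * x\<^sup>2 + a"
  shows "Affine x y \<boxplus> Affine x y = Affine (s\<^sup>2 - x - x) (s * (x - (s\<^sup>2 - x - x)) - y)"
proof -
  have "(3 * x\<^sup>2 + a) / (2 * y) = s" using assms two_neq_0 by (simp add: field_simps)
  moreover have "y \<noteq> - y" using assms neg_eq_self_iff by metis
  ultimately show ?thesis by (simp add: Let_def)
qed

text \<open>Expanding the square leaves the cross term \<open>2 * y2 * s\<close>, which the third
  assumption supplies without division. It serves chord and tangent alike: for
  \<open>x1 = x2\<close> it is the tangency condition.\<close>

lemma third_point_on_curve: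
  assumes "y2\<^sup>2 = cubic x2" "s\<^sup>2 = x1 + x2 + x3"
    "3 * x2\<^sup>2 + a - 2 * y2 * s = (x2 - x1) * (x2 - x3)"
  shows "(s * (x2 - x3) - y2)\<^sup>2 = cubic x3"
proof -
  have t: "2 * y2 * s = 3 * x2\<^sup>2 + a - (x2 - x1) * (x2 - x3)"
    using assms(3) by (simp add: algebra_simps)
  have "(s * (x2 - x3) - y2)\<^sup>2 = s\<^sup>2 * (x2 - x3)\<^sup>2 - (2 * y2 * s) * (x2 - x3) + y2\<^sup>2"
    by Groebner_Basis.algebra
  also have "\<dots> = cubic x3" unfolding assms t by Groebner_Basis.algebra
  finally show ?thesis .
qed

text \<open>The line through the summands meets the curve in a third point; the product formula below
  is the derivative of \<open>cubic X - (s (X - x2) + y2)\<^sup>2 = (X - x1) (X - x2) (X - x3)\<close> at \<open>X = x2\<close>.\<close>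

lemma add_affine_cases:
  assumes "on_curve a b (Affine x1 y1)" "on_curve a b (Affine x2 y2)"
  obtains (inverse) "x1 = x2" "y1 = - y2" "Affine x1 y1 \<boxplus> Affine x2 y2 = Infinity"
  | (line) s x3 y3 where "Affine x1 y1 \<boxplus> Affine x2 y2 = Affine x3 y3"
      "x3 = s\<^sup>2 - x1 - x2" "y3 = s * (x2 - x3) - y2" "s * (x2 - x1) = y2 - y1"
      "3 * x2\<^sup>2 + a - 2 * y2 * s = (x2 - x1) * (x2 - x3)" "y3\<^sup>2 = cubic x3"
      "x1 = x2 \<Longrightarrow> y1 = y2 \<and> y2 \<noteq> 0"
proof (cases "x1 = x2")
  case True
  show ?thesis
  proof (cases "y1 = - y2")
    case True
    with \<open>x1 = x2\<close> show ?thesis by (intro inverse) auto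
  next
    case False
    with same_x[OF assms(2)] assms True have y: "y1 = y2" by auto
    with False have y0: "y2 \<noteq> 0" by auto
    define s where "s = (3 * x2\<^sup>2 + a) / (2 * y2)"
    have s: "s * (2 * y2) = 3 * x2\<^sup>2 + a" using y0 two_neq_0 by (simp add: s_def)
    define x3 where "x3 = s\<^sup>2 - x2 - x2"
    show ?thesis
    proof (rule line)
      show "Affine x1 y1 \<boxplus> Affine x2 y2 = Affine x3 (s * (x2 - x3) - y2)"
        using add_tangent[OF y0 s] True y by (simp add: x3_def)
      show "x3 = s\<^sup>2 - x1 - x2" using True by (simp add: x3_def)
      show "s * (x2 - x1) = y2 - y1" using True y by simp
      show "3 * x2\<^sup>2 + a - 2 * y2 * s = (x2 - x1) * (x2 - x3)" using s True by (simp add: ac_simps)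
      show "(s * (x2 - x3) - y2)\<^sup>2 = cubic x3"
        using assms s by (intro third_point_on_curve[where ?x1.0 = x2]) (simp_all add: x3_def ac_simps)
    qed (use y y0 in auto)
  qed
next
  case False
  define s where "s = (y2 - y1) / (x2 - x1)"
  have s: "s * (x2 - x1) = y2 - y1" using False by (simp add: s_def)
  define x3 where "x3 = s\<^sup>2 - x1 - x2"
  have c: "y1\<^sup>2 = cubic x1" "y2\<^sup>2 = cubic x2" using assms by auto
  \<comment> \<open>Multiplying by \<open>x2 - x1\<close> turns the slope into
    \<open>y2 - y1\<close>; the curve equations then eliminate the squares of \<open>y1\<close> and
    \<open>y2\<close>, and the factor cancels.\<close>
  have "(x2 - x1) * (3 * x2\<^sup>2 + a - 2 * y2 * s)
      = (x2 - x1) * (3 * x2\<^sup>2 + a) - 2 * y2 * (s * (x2 - x1))"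
    by Groebner_Basis.algebra
  also have "\<dots> = (x2 - x1) * (3 * x2\<^sup>2 + a) - (y2 - y1)\<^sup>2 - y2\<^sup>2 + y1\<^sup>2"
    unfolding s by Groebner_Basis.algebra
  also have "\<dots> = (x2 - x1)\<^sup>2 * (2 * x2 + x1) - (s * (x2 - x1))\<^sup>2"
    unfolding c s by Groebner_Basis.algebra
  also have "\<dots> = (x2 - x1) * ((x2 - x1) * (x2 - x3))" unfolding x3_def by Groebner_Basis.algebra
  finally have d: "3 * x2\<^sup>2 + a - 2 * y2 * s = (x2 - x1) * (x2 - x3)" using False by simp
  show ?thesis
  proof (rule line)
    show "Affine x1 y1 \<boxplus> Affine x2 y2 = Affine x3 (s * (x2 - x3) - y2)"
      using add_chord[OF False s] s by (simp add: x3_def algebra_simps)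
    show "(s * (x2 - x3) - y2)\<^sup>2 = cubic x3" by (rule third_point_on_curve[OF c(2) _ d]) (simp add: x3_def)
  qed (use s d x3_def False in auto)
qed

lemma on_curve_add: "on_curve a b P \<Longrightarrow> on_curve a b Q \<Longrightarrow> on_curve a b (P \<boxplus> Q)"
proof (cases P; cases Q)
  fix x1 y1 x2 y2
  assume "on_curve a b P" "on_curve a b Q" and [simp]: "P = Affine x1 y1" "Q = Affine x2 y2"
  then have "on_curve a b (Affine x1 y1)" "on_curve a b (Affine x2 y2)" by auto
  then show ?thesis
    by (cases rule: add_affine_cases) (simp_all del: point_add.simps)
qed auto

text \<open>The line through \<open>M + P\<close> and \<open>-P\<close> is the mirror image of the
  line through \<open>M\<close> and \<open>P\<close>: it has slope \<open>- s\<close> and meets the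
  curve again in \<open>-M\<close>, so the sum is \<open>M\<close>.\<close>

lemma add_neg_cancel:
  assumes "on_curve a b M" "on_curve a b P"
  shows "(M \<boxplus> P) \<boxplus> point_neg P = M"
proof (cases M; cases P)
  fix x1 y1 x2 y2
  assume MP: "M = Affine x1 y1" "P = Affine x2 y2"
  then have on: "on_curve a b (Affine x1 y1)" "on_curve a b (Affine x2 y2)" using assms by auto
  then have y2: "y2\<^sup>2 = cubic x2" by simp
  from on show ?thesis
  proof (cases rule: add_affine_cases)
    case inverse
    then show ?thesis using MP by simp
  next
    case (line s x3 y3)
    have "Affine x3 y3 \<boxplus> Affine x2 (- y2) = Affine x1 y1"
    proof (cases "x3 = x2")
      case False
      have "- s * (x2 - x3) = - y2 - y3" using line by (simp add: algebra_simps)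
      from add_chord[OF False this]
      have "Affine x3 y3 \<boxplus> Affine x2 (- y2) = Affine (s\<^sup>2 - x3 - x2)
          (- s * (x3 - (s\<^sup>2 - x3 - x2)) - y3)"
        by (simp del: point_add.simps)
      moreover have "s\<^sup>2 - x3 - x2 = x1" using line by simp
      moreover have "- s * (x3 - x1) - y3 = y2 - s * (x2 - x1)" unfolding line(3) by Groebner_Basis.algebra
      then have "- s * (x3 - x1) - y3 = y1" using line(4) by simp
      ultimately show ?thesis by simp
    next
      \<comment> \<open>Here the line through \<open>M\<close> and \<open>P\<close> is tangent at
        \<open>P\<close>, so \<open>M + P = -P\<close> and the sum to compute is a doubling.\<close>
      case True
      then have y3: "y3 = - y2" and d: "3 * x2\<^sup>2 + a = 2 * y2 * s" using line by auto
      \<comment> \<open>Otherwise the cubic and its derivative would both vanish at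
        \<open>x2\<close>.\<close>
      have "y2 \<noteq> 0" using d smooth[of x2] y2 by auto
      then have "- y2 \<noteq> 0" by simp
      moreover have "- s * (2 * - y2) = 3 * x2\<^sup>2 + a" using d by (simp add: ac_simps)
      ultimately have "Affine x2 (- y2) \<boxplus> Affine x2 (- y2) = Affine (s\<^sup>2 - x2 - x2)
          (- s * (x2 - (s\<^sup>2 - x2 - x2)) - (- y2))"
        using add_tangent[of "- y2" "- s" x2] unfolding power2_minus by blast
      moreover have "s\<^sup>2 - x2 - x2 = x1" using line True by simp
      moreover have "- s * (x2 - x1) - (- y2) = y2 - s * (x2 - x1)" by Groebner_Basis.algebra
      then have "- s * (x2 - x1) - (- y2) = y1" using line(4) by simp
      ultimately show ?thesis using True y3 by simp
    qed
    then show ?thesis using MP line by (simp del: point_add.simps)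
  qed
qed auto

section \<open>The quadratic satisfied by the x-coordinates of a sum and a difference\<close>

text \<open>\<open>x(M + P)\<close> and \<open>x(M - P)\<close> are the roots of \<open>xform_den T\<^sup>2 - xform_mid T + xform_num\<close>, where
  \<open>x(M) = u / v\<close> and \<open>x(P) = x\<close>.\<close>

definition xform_den :: "'f \<Rightarrow> 'f \<Rightarrow> 'f \<Rightarrow> 'f" where
  "xform_den u v x = (u - x * v)\<^sup>2"
definition xform_num :: "'f \<Rightarrow> 'f \<Rightarrow> 'f \<Rightarrow> 'f" where
  "xform_num u v x = (u * x - a * v)\<^sup>2 - 4 * b * v * (u + x * v)"
definition xform_mid :: "'f \<Rightarrow> 'f \<Rightarrow> 'f \<Rightarrow> 'f" where
  "xform_mid u v x = 2 * ((u + x * v) * (u * x + a * v) + 2 * b * v\<^sup>2)"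

lemmas xform_defs = xform_den_def xform_num_def xform_mid_def

text \<open>If the leading coefficient vanishes, then \<open>u = x * v\<close>, and the other two
  coefficients are, up to \<open>v\<^sup>2\<close>, the numerator and the denominator of the
  duplication formula. A common zero of these would be a common zero of the cubic and its
  derivative.\<close>

lemma xform_nonzero:
  assumes "u \<noteq> 0 \<or> v \<noteq> 0"
  shows "xform_den u v x \<noteq> 0 \<or> xform_num u v x \<noteq> 0 \<or> xform_mid u v x \<noteq> 0"
proof (rule ccontr)
  assume "\<not> ?thesis"
  then have u: "u = x * v" and n: "xform_num u v x = 0" and m: "xform_mid u v x = 0"
    by (auto simp: xform_den_def)
  with assms have v: "v \<noteq> 0" by auto
  have "xform_mid u v x = 4 * cubic x * v\<^sup>2" "xform_num u v x = ((x\<^sup>2 - a)\<^sup>2 - 8 * b * x) * v\<^sup>2"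
    unfolding u xform_defs by Groebner_Basis.algebra+
  with n m have "4 * cubic x * v\<^sup>2 = 0" "((x\<^sup>2 - a)\<^sup>2 - 8 * b * x) * v\<^sup>2 = 0" by simp_all
  with v four_neq_0 have "cubic x = 0" and e: "(x\<^sup>2 - a)\<^sup>2 - 8 * b * x = 0"
    by (simp_all only: mult_eq_0_iff power_eq_0_iff) simp_all
  have "(3 * x\<^sup>2 + a)\<^sup>2 = ((x\<^sup>2 - a)\<^sup>2 - 8 * b * x) + 8 * x * cubic x" by Groebner_Basis.algebra
  then have "(3 * x\<^sup>2 + a)\<^sup>2 = 0" using \<open>cubic x = 0\<close> e by simp
  then show False using smooth[OF \<open>cubic x = 0\<close>] by simp
qed

text \<open>After multiplication by \<open>x1 - x\<close> the slopes \<open>s\<close> and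
  \<open>t\<close> become, up to sign conventions, \<open>y1 - y\<close> and \<open>y1 + y\<close>.
  In the combinations below only squares of \<open>y\<close> and \<open>y1\<close> remain, up to one
  factor, and the curve equation removes them. The first two identities are Vieta's formulas; the
  last two concern the y-coordinates of \<open>M + P\<close> and \<open>M - P\<close> and serve the
  invariant differential.\<close>

lemma chord_sum_diff:
  assumes c: "y1\<^sup>2 = cubic x1" "y\<^sup>2 = cubic x" and ne: "x1 \<noteq> x" and s: "s * (x - x1) = y - y1"
    and t: "t * (x - x1) = - y - y1"
    and x3: "x3 = s\<^sup>2 - x1 - x" and x4: "x4 = t\<^sup>2 - x1 - x"
  shows "(x3 + x4) * (x1 - x)\<^sup>2 = xform_mid x1 1 x"
    "x3 * x4 * (x1 - x)\<^sup>2 = xform_num x1 1 x"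
    "(s * (x - x3) - y + (t * (x - x4) + y)) * (x1 - x) ^ 3
      = y1 * (2 * (x1 * x + a + (x1 + x) * x) * (x1 - x) - 2 * xform_mid x1 1 x)"
    "(s * (x - x3) - y - (t * (x - x4) + y)) * (x1 - x) ^ 3
      = y * (2 * (x1 * x + a + (x1 + x) * x1) * (x1 - x) + 2 * xform_mid x1 1 x)"
proof -
  define L where "L = (x1 + x) * (x1 - x)\<^sup>2"
  have sd: "s * (x1 - x) = y1 - y" and td: "t * (x1 - x) = y + y1"
    using s t by (simp_all add: algebra_simps)
  have "x3 * (x1 - x)\<^sup>2 = (s * (x1 - x))\<^sup>2 - L"
    "x4 * (x1 - x)\<^sup>2 = (t * (x1 - x))\<^sup>2 - L"
    unfolding x3 x4 L_def by Groebner_Basis.algebra+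
  then have 3: "x3 * (x1 - x)\<^sup>2 = (y1 - y)\<^sup>2 - L" and 4: "x4 * (x1 - x)\<^sup>2 = (y + y1)\<^sup>2 - L"
    using sd td by simp_all
  have "(x3 + x4) * (x1 - x)\<^sup>2 = 2 * y1\<^sup>2 + 2 * y\<^sup>2 - 2 * L"
    using 3 4 by Groebner_Basis.algebra
  also have "\<dots> = xform_mid x1 1 x"
    unfolding c L_def xform_mid_def power_one mult_1_right by Groebner_Basis.algebra
  finally show "(x3 + x4) * (x1 - x)\<^sup>2 = xform_mid x1 1 x" .
  have "(x1 - x)\<^sup>2 * (x3 * x4 * (x1 - x)\<^sup>2) = ((y1 - y)\<^sup>2 - L) * ((y + y1)\<^sup>2 - L)"
    unfolding 3[symmetric] 4[symmetric] by Groebner_Basis.algebra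
  also have "\<dots> = (y1\<^sup>2 - y\<^sup>2)\<^sup>2 - 2 * L * (y1\<^sup>2 + y\<^sup>2) + L\<^sup>2" by Groebner_Basis.algebra
  also have "\<dots> = (x1 - x)\<^sup>2 * xform_num x1 1 x"
    unfolding c L_def xform_num_def power_one mult_1_right by Groebner_Basis.algebra
  finally show "x3 * x4 * (x1 - x)\<^sup>2 = xform_num x1 1 x" using ne by simp
  have "(s * (x - x3) - y) * (x1 - x) ^ 3
      = s * (x1 - x) * (x * (x1 - x)\<^sup>2 - x3 * (x1 - x)\<^sup>2) - y * (x1 - x) ^ 3"
    by Groebner_Basis.algebra
  then have y3: "(s * (x - x3) - y) * (x1 - x) ^ 3
      = (y1 - y) * (x * (x1 - x)\<^sup>2 - (y1 - y)\<^sup>2 + L) - y * (x1 - x) ^ 3"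
    unfolding sd 3 by simp
  have "(t * (x - x4) + y) * (x1 - x) ^ 3
      = t * (x1 - x) * (x * (x1 - x)\<^sup>2 - x4 * (x1 - x)\<^sup>2) + y * (x1 - x) ^ 3"
    by Groebner_Basis.algebra
  then have y4: "(t * (x - x4) + y) * (x1 - x) ^ 3
      = (y + y1) * (x * (x1 - x)\<^sup>2 - (y + y1)\<^sup>2 + L) + y * (x1 - x) ^ 3"
    unfolding td 4 by simp
  have "(s * (x - x3) - y + (t * (x - x4) + y)) * (x1 - x) ^ 3
      = y1 * (2 * (x * (x1 - x)\<^sup>2 + L) - 6 * y\<^sup>2 - 2 * y1\<^sup>2)"
    unfolding distrib_right[of "s * (x - x3) - y"] y3 y4 by Groebner_Basis.algebra
  also have "2 * (x * (x1 - x)\<^sup>2 + L) - 6 * y\<^sup>2 - 2 * y1\<^sup>2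
      = 2 * (x1 * x + a + (x1 + x) * x) * (x1 - x) - 2 * xform_mid x1 1 x"
    unfolding c L_def xform_mid_def power_one mult_1_right by Groebner_Basis.algebra
  finally show "(s * (x - x3) - y + (t * (x - x4) + y)) * (x1 - x) ^ 3
      = y1 * (2 * (x1 * x + a + (x1 + x) * x) * (x1 - x) - 2 * xform_mid x1 1 x)" .
  have "(s * (x - x3) - y - (t * (x - x4) + y)) * (x1 - x) ^ 3
      = y * (- 2 * (x * (x1 - x)\<^sup>2 + L) + 2 * y\<^sup>2 + 6 * y1\<^sup>2 - 2 * (x1 - x) ^ 3)"
    unfolding left_diff_distrib[of "s * (x - x3) - y"] y3 y4 by Groebner_Basis.algebra
  also have "- 2 * (x * (x1 - x)\<^sup>2 + L) + 2 * y\<^sup>2 + 6 * y1\<^sup>2 - 2 * (x1 - x) ^ 3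
      = 2 * (x1 * x + a + (x1 + x) * x1) * (x1 - x) + 2 * xform_mid x1 1 x"
    unfolding c L_def xform_mid_def power_one mult_1_right by Groebner_Basis.algebra
  finally show "(s * (x - x3) - y - (t * (x - x4) + y)) * (x1 - x) ^ 3
      = y * (2 * (x1 * x + a + (x1 + x) * x1) * (x1 - x) + 2 * xform_mid x1 1 x)" .
qed

lemma add_sub_affine:
  assumes c: "on_curve a b (Affine x1 y1)" "on_curve a b (Affine x y)" and ne: "x1 \<noteq> x"
  obtains x3 y3 x4 y4 where
    "Affine x1 y1 \<boxplus> Affine x y = Affine x3 y3"
    "Affine x1 y1 \<boxplus> Affine x (- y) = Affine x4 y4"
    "(x3 + x4) * (x1 - x)\<^sup>2 = xform_mid x1 1 x"
    "x3 * x4 * (x1 - x)\<^sup>2 = xform_num x1 1 x"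
    "(y3 + y4) * (x1 - x) ^ 3
      = y1 * (2 * (x1 * x + a + (x1 + x) * x) * (x1 - x) - 2 * xform_mid x1 1 x)"
    "(y3 - y4) * (x1 - x) ^ 3
      = y * (2 * (x1 * x + a + (x1 + x) * x1) * (x1 - x) + 2 * xform_mid x1 1 x)"
proof -
  define s where "s = (y - y1) / (x - x1)"
  define t where "t = (- y - y1) / (x - x1)"
  have s: "s * (x - x1) = y - y1" and t: "t * (x - x1) = - y - y1"
    using ne by (simp_all add: s_def t_def)
  have y: "s * (x1 - z) - y1 = s * (x - z) - y" "t * (x1 - z) - y1 = t * (x - z) + y" for z
    using s t by (simp_all add: algebra_simps)
  note eqs = chord_sum_diff[OF _ _ ne s t refl refl, OF c[unfolded on_curve_simps]]
  show ?thesis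
    using that[OF add_chord[OF ne s, unfolded y] add_chord[OF ne t, unfolded y] eqs] .
qed

text \<open>In the case \<open>M = P\<close> the point \<open>M - P\<close> is infinite, the leading
  coefficient vanishes, and the other root is given by the duplication formula. If also
  \<open>y = 0\<close>, both roots are infinite and only \<open>xform_num\<close> survives, which
  \<open>xform_nonzero\<close> keeps from vanishing.\<close>

lemma x_ratio_double:
  assumes c: "on_curve a b (Affine x y)" and M: "has_x_ratio (Affine x y) u v"
    and 3: "has_x_ratio (Affine x y \<boxplus> Affine x y) u3 v3" and 4: "has_x_ratio Infinity u4 v4"
  shows "\<exists>c. c \<noteq> 0 \<and> v3 * v4 = c * xform_den u v x \<and> u3 * u4 = c * xform_num u v x
    \<and> u3 * v4 + u4 * v3 = c * xform_mid u v x"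
proof (cases "y = 0")
  case False
  define s where "s = (3 * x\<^sup>2 + a) / (2 * y)"
  have s: "s * (2 * y) = 3 * x\<^sup>2 + a" using False two_neq_0 by (simp add: s_def)
  have v: "v \<noteq> 0" "u = x * v" using M by auto
  have 3: "v3 \<noteq> 0" "u3 = (s\<^sup>2 - x - x) * v3" using 3 unfolding add_tangent[OF False s] by auto
  have 4: "v4 = 0" "u4 \<noteq> 0" using 4 by auto
  have y: "y\<^sup>2 = cubic x" using c by simp
  have mid: "xform_mid u v x = 4 * y\<^sup>2 * v\<^sup>2"
    unfolding v y xform_mid_def by Groebner_Basis.algebra
  have "xform_num u v x = ((3 * x\<^sup>2 + a)\<^sup>2 - 8 * x * cubic x) * v\<^sup>2"
    unfolding v xform_num_def by Groebner_Basis.algebra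
  then have num: "xform_num u v x = (s\<^sup>2 - x - x) * (4 * y\<^sup>2 * v\<^sup>2)"
    unfolding s[symmetric] y[symmetric] by Groebner_Basis.algebra
  define N where "N = 4 * y\<^sup>2 * v\<^sup>2"
  have "N \<noteq> 0" using False v four_neq_0 by (simp add: N_def)
  moreover have "xform_den u v x = 0" by (simp add: xform_den_def v)
  ultimately show ?thesis
    by (intro exI[of _ "u4 * v3 / N"]) (use 3 4 in \<open>simp add: mid num flip: N_def\<close>)
next
  case True
  then have 3: "v3 = 0" "u3 \<noteq> 0" using 3 by auto
  have 4: "v4 = 0" "u4 \<noteq> 0" using 4 by auto
  have v: "v \<noteq> 0" "u = x * v" using M by auto
  have y: "cubic x = 0" using c True by simp
  have den: "xform_den u v x = 0" by (simp add: xform_den_def v)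
  have "xform_mid u v x = 4 * cubic x * v\<^sup>2"
    unfolding v xform_mid_def by Groebner_Basis.algebra
  then have mid: "xform_mid u v x = 0" using y by simp
  have "xform_num u v x \<noteq> 0" using xform_nonzero[of u v x] v den mid by auto
  then show ?thesis
    by (intro exI[of _ "u3 * u4 / xform_num u v x"]) (use 3 4 den mid in simp)
qed

text \<open>Vieta's formulas in homogeneous coordinates, which cover infinite \<open>M\<close>,
  \<open>M + P\<close> and \<open>M - P\<close> as well. The common factor \<open>c\<close> appears
  because the coordinates are fixed only up to scaling.\<close>

lemma x_ratio_add_sub:
  assumes on: "on_curve a b M" "on_curve a b (Affine x y)" and M: "has_x_ratio M u v"
    and 3: "has_x_ratio (M \<boxplus> Affine x y) u3 v3" and 4: "has_x_ratio (M \<boxplus> Affine x (- y)) u4 v4"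
  shows "\<exists>c. c \<noteq> 0 \<and> v3 * v4 = c * xform_den u v x \<and> u3 * u4 = c * xform_num u v x
    \<and> u3 * v4 + u4 * v3 = c * xform_mid u v x"
proof (cases M)
  case Infinity
  then show ?thesis using M 3 4
    by (intro exI[of _ "v3 * v4 / u\<^sup>2"]) (auto simp: xform_defs power2_eq_square)
next
  case (Affine x1 y1)
  then have v: "v \<noteq> 0" "u = x1 * v" using M by auto
  show ?thesis
  proof (cases "x1 = x")
    case False
    obtain x3 y3 x4 y4 where eqs:
      "Affine x1 y1 \<boxplus> Affine x y = Affine x3 y3"
      "Affine x1 y1 \<boxplus> Affine x (- y) = Affine x4 y4"
      "(x3 + x4) * (x1 - x)\<^sup>2 = xform_mid x1 1 x"
      "x3 * x4 * (x1 - x)\<^sup>2 = xform_num x1 1 x"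
      using add_sub_affine[OF on(1)[unfolded Affine] on(2) False] .
    have w: "v3 \<noteq> 0" "u3 = x3 * v3" "v4 \<noteq> 0" "u4 = x4 * v4" using 3 4 eqs Affine by auto
    have h: "xform_mid u v x = xform_mid x1 1 x * v\<^sup>2" "xform_num u v x = xform_num x1 1 x * v\<^sup>2"
      "xform_den u v x = (x1 - x)\<^sup>2 * v\<^sup>2"
      unfolding v xform_defs power_one mult_1_right by Groebner_Basis.algebra+
    have d: "(x1 - x)\<^sup>2 \<noteq> 0" using False by simp
    show ?thesis
      unfolding h eqs(3,4)[symmetric]
      by (intro exI[of _ "v3 * v4 / ((x1 - x)\<^sup>2 * v\<^sup>2)"]) (use d v w in \<open>simp add: field_simps\<close>)
  next
    case True
    then consider "y1 = y" | "y1 = - y" using same_x[OF on(2)] on(1) Affine by auto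
    then show ?thesis
    proof cases
      case 1
      show ?thesis
        by (rule x_ratio_double[of x y]) (use on M 3 4 Affine True 1 in auto)
    next
      \<comment> \<open>For \<open>M = -P\<close> sum and difference exchange their roles.\<close>
      case 2
      have "\<exists>c. c \<noteq> 0 \<and> v4 * v3 = c * xform_den u v x \<and> u4 * u3 = c * xform_num u v x
          \<and> u4 * v3 + u3 * v4 = c * xform_mid u v x"
        by (rule x_ratio_double[of x "- y"]) (use on M 3 4 Affine True 2 in auto)
      then show ?thesis by (simp add: ac_simps)
    qed
  qed
qed

text \<open>Both sides are the coefficients of products of linear forms that share the factor
  \<open>(u4 : v4)\<close>; cancelling it leaves the other factor with the same constant.\<close>

lemma ratio_unique:
  assumes "c \<noteq> 0" "u4 \<noteq> 0 \<or> v4 \<noteq> (0::'f)" "v1 * v4 = c * (v3 * v4)" "u1 * u4 = c * (u3 * u4)"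
    "u1 * v4 + u4 * v1 = c * (u3 * v4 + u4 * v3)"
  shows "u1 = c * u3" "v1 = c * v3"
proof -
  have "u1 = c * u3 \<and> v1 = c * v3"
  proof (cases "v4 = 0")
    case True
    with assms show ?thesis by (simp add: ac_simps)
  next
    case False
    then have "v1 = c * v3" using assms by (simp add: ac_simps)
    moreover from this have "u1 * v4 = c * u3 * v4" using assms(5) by (simp add: algebra_simps)
    ultimately show ?thesis using False by simp
  qed
  then show "u1 = c * u3" "v1 = c * v3" by auto
qed

end

section \<open>The multiplication polynomials\<close>

text \<open>A nonzero \<open>p\<close> with a root is nonconstant; then \<open>p + 1\<close> is
  nonconstant and has value 1 everywhere, although it must have a root.\<close>

lemma poly_zero_everywhere:
  fixes p :: "'f::alg_closed_field poly"
  assumes "\<And>x. poly p x = 0"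
  shows "p = 0"
proof (rule ccontr)
  assume "p \<noteq> 0"
  then have "Polynomial.degree p > 0" using assms poly_zero by blast
  then have "Polynomial.degree (p + 1) > 0" by (simp add: degree_add_eq_left)
  then obtain z where "poly (p + 1) z = 0" using alg_closed_imp_poly_has_root by blast
  then show False using assms by simp
qed

lemma poly_eqI_everywhere:
  fixes p :: "'f::alg_closed_field poly"
  assumes "\<And>x. poly p x = poly q x"
  shows "p = q"
  using poly_zero_everywhere[of "p - q"] assms by simp

text \<open>Induction on the degree: a root of \<open>p\<close> is no root of \<open>q\<close>,
  hence a root of \<open>r\<close>, and its linear factor is removed from both. This makes the
  divisions in \<open>mult_poly\<close> exact.\<close>

lemma dvd_mult_no_common_root:
  fixes p :: "'f::alg_closed_field poly"
  assumes "p \<noteq> 0" "\<And>x. poly p x = 0 \<Longrightarrow> poly q x \<noteq> 0" "p dvd r * q"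
  shows "p dvd r"
  using assms
proof (induction "Polynomial.degree p" arbitrary: p r)
  case 0
  then show ?case by (metis is_unit_iff_degree unit_imp_dvd)
next
  case (Suc n)
  then obtain z where z: "poly p z = 0"
    using alg_closed_imp_poly_has_root[of p] by auto
  then obtain p' where p': "p = [:- z, 1:] * p'" by (meson dvdE poly_eq_0_iff_dvd)
  from Suc.prems obtain s where s: "r * q = p * s" by (elim dvdE)
  have "poly (r * q) z = 0" unfolding s using z by simp
  then have "poly r z = 0" using Suc.prems(2)[OF z] by simp
  then obtain r' where r': "r = [:- z, 1:] * r'" by (meson dvdE poly_eq_0_iff_dvd)
  have "[:- z, 1:] * (r' * q) = [:- z, 1:] * (p' * s)"
    using s unfolding p' r' by (simp only: mult.assoc)
  then have "p' dvd r' * q" by (metis dvd_triv_left mult_left_cancel pCons_eq_0_iff one_neq_zero)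
  moreover have "p' \<noteq> 0" using Suc.prems p' by auto
  moreover have "n = Polynomial.degree p'"
    using Suc.hyps(2) \<open>p' \<noteq> 0\<close> unfolding p' by (subst (asm) degree_mult_eq) auto
  moreover have "poly q x \<noteq> 0" if "poly p' x = 0" for x
    using Suc.prems(2)[of x] that p' by simp
  ultimately have "p' dvd r'" using Suc.hyps(1) by blast
  then show ?case unfolding p' r' by (rule mult_dvd_mono[OF dvd_refl])
qed

lemma coeff_mult_top:
  assumes "Polynomial.degree p \<le> d" "Polynomial.degree q \<le> e"
  shows "Polynomial.coeff (p * q) (d + e) = Polynomial.coeff p d * Polynomial.coeff q e"
proof -
  have "Polynomial.coeff p i * Polynomial.coeff q (d + e - i) = 0" if "i \<le> d + e" "i \<noteq> d" for i
    using that assms by (cases "i < d") (simp_all add: Polynomial.coeff_eq_0)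
  then have "Polynomial.coeff (p * q) (d + e)
      = (\<Sum>i\<in>{d}. Polynomial.coeff p i * Polynomial.coeff q (d + e - i))"
    unfolding Polynomial.coeff_mult by (intro sum.mono_neutral_right) auto
  then show ?thesis by simp
qed

lemma coeff_mult_second:
  assumes "Polynomial.degree p \<le> Suc d" "Polynomial.degree q \<le> Suc e"
  shows "Polynomial.coeff (p * q) (Suc (d + e))
    = Polynomial.coeff p (Suc d) * Polynomial.coeff q e
      + Polynomial.coeff p d * Polynomial.coeff q (Suc e)"
proof -
  have "Polynomial.coeff p i * Polynomial.coeff q (Suc (d + e) - i) = 0"
    if "i \<le> Suc (d + e)" "i \<noteq> d" "i \<noteq> Suc d" for i
    using that assms by (cases "i < d") (simp_all add: Polynomial.coeff_eq_0)
  then have "Polynomial.coeff (p * q) (Suc (d + e))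
      = (\<Sum>i\<in>{d, Suc d}. Polynomial.coeff p i * Polynomial.coeff q (Suc (d + e) - i))"
    unfolding Polynomial.coeff_mult by (intro sum.mono_neutral_right) auto
  then show ?thesis by (simp add: Suc_diff_le add.commute)
qed

context weierstrass begin

definition pform_den :: "'f poly \<Rightarrow> 'f poly \<Rightarrow> 'f poly" where
  "pform_den A B = (A - [:0, 1:] * B)\<^sup>2"
definition pform_num :: "'f poly \<Rightarrow> 'f poly \<Rightarrow> 'f poly" where
  "pform_num A B = (A * [:0, 1:] - [:a:] * B)\<^sup>2 - [:4 * b:] * (B * (A + [:0, 1:] * B))"
definition pform_mid :: "'f poly \<Rightarrow> 'f poly \<Rightarrow> 'f poly" where
  "pform_mid A B = [:2:] * ((A + [:0, 1:] * B) * (A * [:0, 1:] + [:a:] * B) + [:2 * b:] * B\<^sup>2)"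

lemmas pform_defs = pform_den_def pform_num_def pform_mid_def

lemma poly_pform [simp]:
  "poly (pform_den A B) x = xform_den (poly A x) (poly B x) x"
  "poly (pform_num A B) x = xform_num (poly A x) (poly B x) x"
  "poly (pform_mid A B) x = xform_mid (poly A x) (poly B x) x"
  by (simp_all add: pform_defs xform_defs ac_simps)

end

section \<open>Degrees and the two leading coefficients\<close>

text \<open>The index \<open>d\<close> is one less than the degree, so that the second coefficient
  is named without subtraction; its vanishing means that the roots sum to 0.\<close>

definition monic_depressed :: "nat \<Rightarrow> 'f::comm_ring_1 poly \<Rightarrow> bool" where
  "monic_depressed d p \<longleftrightarrow> Polynomial.degree p \<le> Suc d \<and> Polynomial.coeff p (Suc d) = 1
    \<and> Polynomial.coeff p d = 0"

lemma monic_depressed_degree: "monic_depressed d p \<Longrightarrow> Polynomial.degree p = Suc d"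
  unfolding monic_depressed_def by (metis le_antisym le_degree one_neq_zero)

text \<open>Comparing the two top coefficients of \<open>p * q\<close> and \<open>q\<close>
  determines those of the quotient \<open>p\<close>.\<close>

lemma monic_depressed_mult_left:
  fixes p q :: "'f::idom poly"
  assumes "monic_depressed e q" "monic_depressed (Suc (d + e)) (p * q)"
  shows "monic_depressed d p"
proof -
  have "p \<noteq> 0" "q \<noteq> 0" using assms by (auto simp: monic_depressed_def)
  then have "Polynomial.degree p = Suc d"
    using monic_depressed_degree[OF assms(1)] monic_depressed_degree[OF assms(2)]
    by (simp add: degree_mult_eq)
  then have d: "Polynomial.degree p \<le> Suc d" by simp
  have q: "Polynomial.degree q \<le> Suc e" using assms by (simp add: monic_depressed_def)
  have "Polynomial.coeff p (Suc d) = 1"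
    using coeff_mult_top[OF d q] assms by (simp add: monic_depressed_def)
  moreover have "Polynomial.coeff p d = 0"
    using coeff_mult_second[OF d q] assms by (simp add: monic_depressed_def)
  ultimately show ?thesis using d by (simp add: monic_depressed_def)
qed

lemma monic_depressed_mult:
  assumes "monic_depressed d p" "monic_depressed e q"
  shows "monic_depressed (Suc (d + e)) (p * q)"
  using assms coeff_mult_top[of p "Suc d" q "Suc e"] coeff_mult_second[of p d q e]
    degree_mult_le[of p q]
  unfolding monic_depressed_def by auto

lemma monic_depressed_add:
  assumes "monic_depressed d p" "Polynomial.degree q < d"
  shows "monic_depressed d (p + q)" "monic_depressed d (p - q)"
  using assms unfolding monic_depressed_def
  by (auto intro!: degree_add_le degree_diff_le simp: Polynomial.coeff_eq_0)

lemma monic_depressed_mult_X: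
  assumes "monic_depressed d p"
  shows "monic_depressed (Suc d) (p * [:0, 1:])"
  using assms unfolding monic_depressed_def
  by (auto simp: le_SucI intro: order.trans[OF degree_pCons_le])

context weierstrass begin

lemma pform_num_depressed:
  assumes A: "monic_depressed d A" and B: "Polynomial.degree B \<le> d"
  shows "monic_depressed (2 * d + 3) (pform_num A B)"
proof -
  have "Polynomial.degree ([:a:] * B) < Suc d"
    using B by (auto intro: le_less_trans[OF degree_smult_le])
  from monic_depressed_add(2)[OF monic_depressed_mult_X[OF A] this]
  have "monic_depressed (Suc d) (A * [:0, 1:] - [:a:] * B)" .
  from monic_depressed_mult[OF this this]
  have 1: "monic_depressed (2 * d + 3) ((A * [:0, 1:] - [:a:] * B)\<^sup>2)"
    by (simp add: power2_eq_square numeral_3_eq_3 mult_2)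
  have "Polynomial.degree (A + [:0, 1:] * B) \<le> Suc d"
    using A B unfolding monic_depressed_def
    by (intro degree_add_le) (auto intro: order.trans[OF degree_pCons_le])
  then have "Polynomial.degree (B * (A + [:0, 1:] * B)) \<le> d + Suc d"
    using B by (intro order.trans[OF degree_mult_le] add_mono)
  then have "Polynomial.degree ([:4 * b:] * (B * (A + [:0, 1:] * B))) < 2 * d + 3"
    using degree_smult_le[of "4 * b" "B * (A + [:0, 1:] * B)"] by simp
  from monic_depressed_add(2)[OF 1 this] show ?thesis unfolding pform_num_def .
qed

lemma pform_mid_top:
  assumes A: "monic_depressed d A" and B: "Polynomial.degree B \<le> d"
  shows "Polynomial.degree (pform_mid A B) \<le> 2 * d + 3"
    "Polynomial.coeff (pform_mid A B) (2 * d + 3) = 2 * (1 + Polynomial.coeff B d)"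
proof -
  define p where "p = A + [:0, 1:] * B"
  define q where "q = A * [:0, 1:] + [:a:] * B"
  have p: "Polynomial.degree p \<le> Suc d"
    using A B unfolding monic_depressed_def p_def
    by (intro degree_add_le) (auto intro: order.trans[OF degree_pCons_le])
  have pc: "Polynomial.coeff p (Suc d) = 1 + Polynomial.coeff B d"
    using A by (simp add: p_def monic_depressed_def)
  have "Polynomial.degree ([:a:] * B) < Suc d"
    using B by (auto intro: le_less_trans[OF degree_smult_le])
  from monic_depressed_add(1)[OF monic_depressed_mult_X[OF A] this]
  have q: "monic_depressed (Suc d) q" unfolding q_def .
  then have qd: "Polynomial.degree q \<le> Suc (Suc d)" by (simp add: monic_depressed_def)
  have B2: "Polynomial.degree ([:2 * b:] * B\<^sup>2) \<le> 2 * d"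
    using B degree_mult_le[of B B] degree_smult_le[of "2 * b" "B\<^sup>2"]
    by (simp add: power2_eq_square)
  have pq: "Polynomial.degree (p * q) \<le> 2 * d + 3"
    using degree_mult_le[of p q] p qd by simp
  have eq: "pform_mid A B = Polynomial.smult 2 (p * q + [:2 * b:] * B\<^sup>2)"
    by (simp add: pform_mid_def p_def q_def)
  have "Polynomial.degree (p * q + [:2 * b:] * B\<^sup>2) \<le> 2 * d + 3"
    using pq B2 by (intro degree_add_le) auto
  then show "Polynomial.degree (pform_mid A B) \<le> 2 * d + 3"
    unfolding eq by (rule order.trans[OF degree_smult_le])
  have "Polynomial.coeff (p * q) (2 * d + 3) = 1 + Polynomial.coeff B d"
    using coeff_mult_top[OF p qd] pc q by (simp add: monic_depressed_def mult_2 numeral_3_eq_3)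
  moreover have "Polynomial.coeff ([:2 * b:] * B\<^sup>2) (2 * d + 3) = 0"
    using B2 by (intro Polynomial.coeff_eq_0) simp
  ultimately show "Polynomial.coeff (pform_mid A B) (2 * d + 3) = 2 * (1 + Polynomial.coeff B d)"
    unfolding eq by (simp only: Polynomial.coeff_smult Polynomial.coeff_add) simp
qed

section \<open>Multiples of a point and the polynomials for their x-coordinates\<close>

primrec point_mult :: "nat \<Rightarrow> 'f point \<Rightarrow> 'f point" where
  "point_mult 0 P = Infinity"
| "point_mult (Suc n) P = point_mult n P \<boxplus> P"

lemma on_curve_mult: "on_curve a b P \<Longrightarrow> on_curve a b (point_mult n P)"
  by (induction n) (auto intro: on_curve_add)

lemma mult_Suc_sub: "on_curve a b P \<Longrightarrow> point_mult (Suc n) P \<boxplus> point_neg P = point_mult n P"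
  by (simp add: add_neg_cancel on_curve_mult)

text \<open>The numerator and denominator of \<open>x(nP)\<close> as functions of \<open>x(P)\<close>. The divisions are exact;
  \<open>n = 2\<close> has its own clause because the denominator for \<open>n = 0\<close> is \<open>0\<close>.\<close>

fun mult_poly :: "nat \<Rightarrow> 'f poly \<times> 'f poly" where
  "mult_poly 0 = (1, 0)"
| "mult_poly (Suc 0) = ([:0, 1:], 1)"
| "mult_poly (Suc (Suc 0)) = (pform_num [:0, 1:] 1, pform_mid [:0, 1:] 1)"
| "mult_poly (Suc (Suc (Suc n))) = (let (A, B) = mult_poly (Suc (Suc n)); (C, D) = mult_poly (Suc n)
    in (pform_num A B div C, pform_den A B div D))"

abbreviation "num n \<equiv> fst (mult_poly n)"
abbreviation "den n \<equiv> snd (mult_poly n)"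

lemma num_step: "num (Suc (Suc (Suc n)))
    = pform_num (num (Suc (Suc n))) (den (Suc (Suc n))) div num (Suc n)"
  and den_step: "den (Suc (Suc (Suc n)))
    = pform_den (num (Suc (Suc n))) (den (Suc (Suc n))) div den (Suc n)"
  by (simp_all add: case_prod_unfold Let_def)

declare mult_poly.simps(4) [simp del]

definition mult_poly_correct :: "nat \<Rightarrow> bool" where
  "mult_poly_correct n \<longleftrightarrow> (\<forall>x y. on_curve a b (Affine x y) \<longrightarrow>
     has_x_ratio (point_mult n (Affine x y)) (poly (num n) x) (poly (den n) x))"

text \<open>With \<open>n = k + 1\<close> the number \<open>k * (k + 2)\<close> is
  \<open>n^2 - 1\<close>, written without subtraction.\<close>

definition mult_poly_top :: "nat \<Rightarrow> bool" where
  "mult_poly_top k \<longleftrightarrow> monic_depressed (k * (k + 2)) (num (Suc k)) \<and>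
     Polynomial.degree (den (Suc k)) \<le> k * (k + 2) \<and>
     Polynomial.coeff (den (Suc k)) (k * (k + 2)) = (of_nat (Suc k))\<^sup>2"

text \<open>Vieta's formulas for \<open>M = (k + 1) P\<close>, as polynomial identities with the
  factor normalized to 1.\<close>

definition mult_poly_recurrence :: "nat \<Rightarrow> bool" where
  "mult_poly_recurrence k \<longleftrightarrow> num (k + 2) * num k = pform_num (num (k + 1)) (den (k + 1)) \<and>
     den (k + 2) * den k = pform_den (num (k + 1)) (den (k + 1)) \<and>
     num (k + 2) * den k + num k * den (k + 2) = pform_mid (num (k + 1)) (den (k + 1))"

lemma mult_poly_base:
  "mult_poly_recurrence 0" "mult_poly_top 0" "mult_poly_top 1"
  "mult_poly_correct 0" "mult_poly_correct 1"
proof -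
  show "mult_poly_recurrence 0"
    by (simp add: mult_poly_recurrence_def numeral_2_eq_2 pform_den_def)
  show "mult_poly_top 0"
    by (simp add: mult_poly_top_def monic_depressed_def)
  have X: "monic_depressed 0 [:0, 1:: 'f:]" by (simp add: monic_depressed_def)
  show "mult_poly_top 1"
    using pform_num_depressed[OF X, of 1] pform_mid_top[OF X, of 1]
    by (simp add: mult_poly_top_def numeral_3_eq_3)
  show "mult_poly_correct 0" "mult_poly_correct 1"
    by (simp_all add: mult_poly_correct_def)
qed

text \<open>The numerator comes from the product \<open>U * C\<close>. The denominator is read off
  in the sum of the roots, where \<open>V\<close> is multiplied by the monic \<open>C\<close>; in
  \<open>V * D\<close> the known coefficient of \<open>D\<close> may be 0 in positive
  characteristic.\<close>

lemma mult_poly_top_step: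
  assumes "mult_poly_top k" "mult_poly_top (Suc k)" "mult_poly_recurrence (Suc k)"
  shows "mult_poly_top (Suc (Suc k))"
proof -
  define d e g where "d = Suc k * (Suc k + 2)" and "e = k * (k + 2)"
    and "g = Suc (Suc k) * (Suc (Suc k) + 2)"
  \<comment> \<open>For \<open>n = k + 2\<close> this is
    \<open>(n + 1)^2 + (n - 1)^2 = 2 n^2 + 2\<close>.\<close>
  have sum: "Suc (g + e) = 2 * d + 3" by (simp add: d_def e_def g_def algebra_simps)
  define A B C D U V where "A = num (Suc (Suc k))" and "B = den (Suc (Suc k))"
    and "C = num (Suc k)" and "D = den (Suc k)"
    and "U = num (Suc (Suc (Suc k)))" and "V = den (Suc (Suc (Suc k)))"
  note defs = A_def B_def C_def D_def U_def V_def d_def e_def g_def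
  have A: "monic_depressed d A" and B: "Polynomial.degree B \<le> d"
    "Polynomial.coeff B d = (of_nat (Suc (Suc k)))\<^sup>2"
    and C: "monic_depressed e C" and D: "Polynomial.degree D \<le> e"
    "Polynomial.coeff D e = (of_nat (Suc k))\<^sup>2"
    using assms(1,2) unfolding mult_poly_top_def defs by auto
  have UC: "U * C = pform_num A B" and mid: "U * D + C * V = pform_mid A B"
    using assms(3) unfolding mult_poly_recurrence_def defs by (simp_all add: numeral_2_eq_2)
  have U: "monic_depressed g U"
    using monic_depressed_mult_left[OF C, of g U] pform_num_depressed[OF A B(1)] UC sum by simp
  have Ud: "Polynomial.degree U \<le> Suc g" using U by (simp add: monic_depressed_def)
  have UD: "Polynomial.degree (U * D) \<le> Suc (g + e)"
    using degree_mult_le[of U D] Ud D by simp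
  have UDc: "Polynomial.coeff (U * D) (Suc (g + e)) = (of_nat (Suc k))\<^sup>2"
    using coeff_mult_top[OF Ud D(1)] U D(2) by (simp add: monic_depressed_def)
  have CV: "C * V = pform_mid A B - U * D" using mid by (simp add: algebra_simps)
  have "Polynomial.degree (C * V) \<le> Suc (g + e)"
    unfolding CV using UD pform_mid_top(1)[OF A B(1)] sum by (intro degree_diff_le) simp_all
  moreover have "C \<noteq> 0" using C by (auto simp: monic_depressed_def)
  ultimately have V: "Polynomial.degree V \<le> g"
    using monic_depressed_degree[OF C] by (cases "V = 0") (simp_all add: degree_mult_eq)
  have Cd: "Polynomial.degree C \<le> Suc e" using C by (simp add: monic_depressed_def)
  have "Polynomial.coeff V g = Polynomial.coeff (C * V) (Suc (g + e))"
    using coeff_mult_top[OF Cd V] C by (simp add: monic_depressed_def add.commute)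
  also have "\<dots> = 2 * (1 + (of_nat (Suc (Suc k)))\<^sup>2) - (of_nat (Suc k))\<^sup>2"
    unfolding CV Polynomial.coeff_diff UDc unfolding sum pform_mid_top(2)[OF A B(1)] B(2) by simp
  \<comment> \<open>The squares solve the recurrence:
    \<open>2 (1 + m^2) - (m - 1)^2 = (m + 1)^2\<close>.\<close>
  also have "\<dots> = (of_nat (Suc (Suc (Suc k))))\<^sup>2"
    by (simp add: power2_eq_square algebra_simps)
  finally show ?thesis
    using U V unfolding mult_poly_top_def defs by blast
qed

end

section \<open>Exactness of the divisions and correctness of the recursion\<close>

locale weierstrass_closed = weierstrass a b for a b :: "'f::alg_closed_field"
begin

lemma point_over: obtains y where "on_curve a b (Affine x y)"
proof -
  obtain y where "y\<^sup>2 = cubic x" using nth_root_exists[of 2 "cubic x"] by auto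
  then show ?thesis by (intro that[of y]) simp
qed

text \<open>The known multiple \<open>(k + 1) P\<close> gives a root \<open>(C : D)\<close> of the
  quadratic formed from \<open>(A, B)\<close>. Read as a polynomial identity, and since
  \<open>C\<close> and \<open>D\<close> have no common root, this makes both divisions exact;
  \<open>ratio_unique\<close> then identifies the quotients with the other root,
  \<open>x((k + 3) P)\<close>.\<close>

lemma mult_poly_step:
  assumes "mult_poly_correct (Suc k)" "mult_poly_correct (Suc (Suc k))" "mult_poly_top k"
  shows "mult_poly_recurrence (Suc k)" "mult_poly_correct (Suc (Suc (Suc k)))"
proof -
  define A B C D U V where "A = num (Suc (Suc k))" and "B = den (Suc (Suc k))"
    and "C = num (Suc k)" and "D = den (Suc k)"
    and "U = num (Suc (Suc (Suc k)))" and "V = den (Suc (Suc (Suc k)))"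
  note defs = A_def B_def C_def D_def U_def V_def
  have sub: "point_mult (Suc (Suc k)) (Affine x y) \<boxplus> Affine x (- y) = point_mult (Suc k) (Affine x y)"
    if "on_curve a b (Affine x y)" for x y
    using mult_Suc_sub[OF that, of "Suc k"] by simp
  have CD: "has_x_ratio (point_mult (Suc k) (Affine x y)) (poly C x) (poly D x)"
    and AB: "has_x_ratio (point_mult (Suc (Suc k)) (Affine x y)) (poly A x) (poly B x)"
    if "on_curve a b (Affine x y)" for x y
    using assms(1,2) that unfolding mult_poly_correct_def defs by blast+
  have rel: "\<exists>c. c \<noteq> 0 \<and> v * poly D x = c * poly (pform_den A B) x
      \<and> u * poly C x = c * poly (pform_num A B) x
      \<and> u * poly D x + poly C x * v = c * poly (pform_mid A B) x"
    if "on_curve a b (Affine x y)" "has_x_ratio (point_mult (Suc (Suc (Suc k))) (Affine x y)) u v"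
    for x y u v
    unfolding poly_pform
    by (rule x_ratio_add_sub[OF on_curve_mult[OF that(1)] that(1) AB[OF that(1)]])
      (use that CD[OF that(1)] sub[OF that(1)] in simp_all)
  have nz: "poly C x \<noteq> 0 \<or> poly D x \<noteq> 0" for x
  proof -
    obtain y where "on_curve a b (Affine x y)" by (rule point_over)
    then show ?thesis using CD has_x_ratio_nonzero by blast
  qed
  \<comment> \<open>This says that \<open>(C : D)\<close> is a root of the quadratic. The factor
    \<open>c\<close> depends on the point and has to cancel before polynomials can be
    compared.\<close>
  have "poly (pform_den A B * C\<^sup>2 + pform_num A B * D\<^sup>2) x = poly (pform_mid A B * (C * D)) x" for x
  proof -
    obtain y where y: "on_curve a b (Affine x y)" by (rule point_over)
    obtain u v where uv: "has_x_ratio (point_mult (Suc (Suc (Suc k))) (Affine x y)) u v"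
      using has_x_ratio_exists by blast
    from rel[OF y uv] obtain c where c: "c \<noteq> 0" "v * poly D x = c * poly (pform_den A B) x"
      "u * poly C x = c * poly (pform_num A B) x"
      "u * poly D x + poly C x * v = c * poly (pform_mid A B) x" by blast
    have "c * poly (pform_den A B * C\<^sup>2 + pform_num A B * D\<^sup>2) x
        = (c * poly (pform_den A B) x) * (poly C x)\<^sup>2 + (c * poly (pform_num A B) x) * (poly D x)\<^sup>2"
      by (simp add: algebra_simps)
    also have "\<dots> = (u * poly D x + poly C x * v) * (poly C x * poly D x)"
      unfolding c(2,3)[symmetric] by Groebner_Basis.algebra
    also have "\<dots> = c * poly (pform_mid A B * (C * D)) x"
      unfolding c(4) by simp
    finally show ?thesis using c(1) by simp
  qed
  then have id: "pform_den A B * C\<^sup>2 + pform_num A B * D\<^sup>2 = pform_mid A B * (C * D)"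
    by (rule poly_eqI_everywhere)
  have C: "monic_depressed (k * (k + 2)) C" using assms(3) by (simp add: mult_poly_top_def C_def)
  then have C0: "C \<noteq> 0" by (auto simp: monic_depressed_def)
  \<comment> \<open>A root of \<open>C\<close> exists and \<open>D\<close> does not vanish there.
    The known coefficient of \<open>D\<close> could be 0 in the field and would not show that
    \<open>D\<close> is nonzero.\<close>
  have "Polynomial.degree C > 0" using monic_depressed_degree[OF C] by simp
  then obtain z where "poly C z = 0" using alg_closed_imp_poly_has_root by blast
  then have D0: "D \<noteq> 0" using nz[of z] by auto
  have "pform_den A B * C\<^sup>2 = D * (pform_mid A B * C - pform_num A B * D)"
    using id by (simp add: algebra_simps power2_eq_square)
  then have "D dvd pform_den A B * C\<^sup>2" by (rule dvdI)
  from dvd_mult_no_common_root[OF D0 _ this] have "D dvd pform_den A B" using nz by auto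
  then have VD: "V * D = pform_den A B" by (simp only: den_step dvd_div_mult_self defs)
  have "pform_num A B * D\<^sup>2 = C * (pform_mid A B * D - pform_den A B * C)"
    using id by (simp add: algebra_simps power2_eq_square)
  then have "C dvd pform_num A B * D\<^sup>2" by (rule dvdI)
  from dvd_mult_no_common_root[OF C0 _ this] have "C dvd pform_num A B" using nz by auto
  then have UC: "U * C = pform_num A B" by (simp only: num_step dvd_div_mult_self defs)
  have "(C * D) * (U * D + C * V) = (C * D) * pform_mid A B"
    using id unfolding VD[symmetric] UC[symmetric] by (simp add: algebra_simps power2_eq_square)
  then have mid: "U * D + C * V = pform_mid A B" using C0 D0 by simp
  show "mult_poly_recurrence (Suc k)"
    using UC VD mid unfolding mult_poly_recurrence_def defs by (simp add: numeral_2_eq_2)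
  have "has_x_ratio (point_mult (Suc (Suc (Suc k))) (Affine x y)) (poly U x) (poly V x)"
    if y: "on_curve a b (Affine x y)" for x y
  proof -
    obtain u v where uv: "has_x_ratio (point_mult (Suc (Suc (Suc k))) (Affine x y)) u v"
      using has_x_ratio_exists by blast
    from rel[OF y uv] obtain c where c: "c \<noteq> 0" "v * poly D x = c * poly (pform_den A B) x"
      "u * poly C x = c * poly (pform_num A B) x"
      "u * poly D x + poly C x * v = c * poly (pform_mid A B) x" by blast
    have "u = c * poly U x" "v = c * poly V x"
      using ratio_unique[OF c(1) nz[of x]] c(2-4)
      unfolding UC[symmetric] VD[symmetric] mid[symmetric] poly_mult poly_add by blast+
    then have "poly U x = inverse c * u" "poly V x = inverse c * v" using c(1) by simp_all
    then show ?thesis using has_x_ratio_scale[OF uv, of "inverse c"] c(1) by simp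
  qed
  then show "mult_poly_correct (Suc (Suc (Suc k)))"
    unfolding mult_poly_correct_def defs by blast
qed

text \<open>The division by the denominator of index 0 is impossible, so this case uses the doubling
  directly, with \<open>(1 : 0)\<close> for the point at infinity.\<close>

lemma mult_poly_correct_2: "mult_poly_correct 2"
  unfolding mult_poly_correct_def
proof (intro allI impI)
  fix x y assume y: "on_curve a b (Affine x y)"
  obtain u v where uv: "has_x_ratio (point_mult 2 (Affine x y)) u v"
    using has_x_ratio_exists by blast
  have "\<exists>c. c \<noteq> 0 \<and> v * 0 = c * xform_den x 1 x \<and> u * 1 = c * xform_num x 1 x
    \<and> u * 0 + 1 * v = c * xform_mid x 1 x"
    by (rule x_ratio_double[OF y]) (use uv in \<open>simp_all add: numeral_2_eq_2\<close>)
  then obtain c where c: "c \<noteq> 0" "u = c * xform_num x 1 x" "v = c * xform_mid x 1 x" by auto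
  then have "xform_num x 1 x = inverse c * u" "xform_mid x 1 x = inverse c * v" by simp_all
  then show "has_x_ratio (point_mult 2 (Affine x y)) (poly (num 2) x) (poly (den 2) x)"
    using has_x_ratio_scale[OF uv, of "inverse c"] c(1) by (simp add: numeral_2_eq_2)
qed

lemma mult_poly_invariant:
  "mult_poly_correct (Suc k) \<and> mult_poly_correct (Suc (Suc k)) \<and>
   mult_poly_top k \<and> mult_poly_top (Suc k) \<and> mult_poly_recurrence k"
proof (induction k)
  case 0
  then show ?case using mult_poly_base mult_poly_correct_2 by (simp add: numeral_2_eq_2)
next
  case (Suc k)
  then show ?case using mult_poly_step[of k] mult_poly_top_step[of k] by blast
qed

lemma mult_poly_correct:
  assumes "on_curve a b (Affine x y)"
  shows "has_x_ratio (point_mult n (Affine x y)) (poly (num n) x) (poly (den n) x)"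
  using mult_poly_invariant[of "n - 1"] mult_poly_base(4) assms
  unfolding mult_poly_correct_def by (cases n) auto

lemma mult_poly_recurrence:
  "num (Suc (Suc k)) * num k = pform_num (num (Suc k)) (den (Suc k))"
  "den (Suc (Suc k)) * den k = pform_den (num (Suc k)) (den (Suc k))"
  "num (Suc (Suc k)) * den k + num k * den (Suc (Suc k)) = pform_mid (num (Suc k)) (den (Suc k))"
  using mult_poly_invariant[of k] by (auto simp: mult_poly_recurrence_def numeral_2_eq_2)

lemmas mult_poly_top = mult_poly_invariant[THEN conjunct2, THEN conjunct2, THEN conjunct1]

end

section \<open>The invariant differential\<close>

text \<open>This is \<open>V^2\<close> times the derivative of \<open>U / V\<close>, so rational
  functions are differentiated without division.\<close>

definition wronskian :: "'a::idom poly \<Rightarrow> 'a poly \<Rightarrow> 'a poly" where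
  "wronskian U V = pderiv U * V - U * pderiv V"

context weierstrass begin

lemma poly_pderiv_pform:
  fixes A B :: "'f poly" and x :: 'f
  defines "A' \<equiv> poly (pderiv A) x" and "B' \<equiv> poly (pderiv B) x"
  shows "poly (pderiv (pform_den A B)) x
      = 2 * (poly A x - x * poly B x) * (A' - poly B x - x * B')"
    "poly (pderiv (pform_num A B)) x
      = 2 * (poly A x * x - a * poly B x) * (A' * x + poly A x - a * B')
        - 4 * b * (B' * (poly A x + x * poly B x) + poly B x * (A' + poly B x + x * B'))"
    "poly (pderiv (pform_mid A B)) x
      = 2 * ((A' + poly B x + x * B') * (poly A x * x + a * poly B x)
        + (poly A x + x * poly B x) * (A' * x + poly A x + a * B') + 4 * b * poly B x * B')"
  unfolding A'_def B'_def pform_defs power2_eq_square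
  by (simp_all add: pderiv_mult pderiv_add pderiv_diff pderiv_smult pderiv_pCons algebra_simps)

text \<open>The derivative of \<open>U / V + C / D = M / N\<close>, cleared of denominators.\<close>

lemma wronskian_sum:
  assumes "U * D + C * V = M" "V * D = (N :: 'f poly)"
  shows "wronskian U V * D\<^sup>2 + wronskian C D * V\<^sup>2 = wronskian M N"
  unfolding wronskian_def assms[symmetric]
  by (simp add: pderiv_mult pderiv_add power2_eq_square algebra_simps)

text \<open>Expanding the fraction \<open>U / V\<close> by \<open>C\<close> keeps its derivative and
  multiplies the Wronskian by \<open>C^2\<close>.\<close>

lemma wronskian_ratio:
  assumes "C * V = M" "U * C = (N :: 'f poly)"
  shows "wronskian U V * C\<^sup>2 = wronskian N M"
  unfolding wronskian_def assms[symmetric]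
  by (simp add: pderiv_mult power2_eq_square algebra_simps)

text \<open>Chain rule for the sum of the roots as a function of \<open>x1 = A / B\<close> and
  \<open>x\<close>, where \<open>q\<close> is the derivative of \<open>A / B\<close>. The brackets
  are the two partial derivatives times \<open>(x1 - x)^3\<close>; the same expressions give
  \<open>y3 + y4\<close> and \<open>y3 - y4\<close> in \<open>add_sub_affine\<close>.\<close>

lemma wronskian_pform:
  fixes A B :: "'f poly"
  assumes A: "poly A x = x1 * B0" and A': "poly (pderiv A) x = q * B0 + x1 * B'"
    and B: "poly B x = B0" and B': "poly (pderiv B) x = B'"
  shows "poly (wronskian (pform_mid A B) (pform_den A B)) x = B0 ^ 4 * (x1 - x) *
      (q * (2 * (x1 * x + a + (x1 + x) * x) * (x1 - x) - 2 * xform_mid x1 1 x)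
       + (2 * (x1 * x + a + (x1 + x) * x1) * (x1 - x) + 2 * xform_mid x1 1 x))"
  unfolding wronskian_def poly_diff poly_mult poly_pderiv_pform poly_pform A A' B B'
    xform_defs power_one mult_1_right
  by Groebner_Basis.algebra

text \<open>For \<open>x1 = x\<close> the form \<open>pform_den\<close> vanishes and one root is
  infinite. The finite root is the quotient of \<open>pform_num\<close> by \<open>pform_mid\<close>,
  and its derivative matches the y-coordinate in \<open>double_affine\<close>.\<close>

lemma wronskian_pform_diag:
  fixes A B :: "'f poly"
  assumes A: "poly A x = x * B0" and A': "poly (pderiv A) x = q * B0 + x * B'"
    and B: "poly B x = B0" and B': "poly (pderiv B) x = B'"
  shows "poly (wronskian (pform_num A B) (pform_mid A B)) x = (q + 1) * B0 ^ 4 *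
      (cubic x * (8 * x * (3 * x\<^sup>2 + a) - 16 * cubic x)
        - 2 * (3 * x\<^sup>2 + a) * ((x\<^sup>2 - a)\<^sup>2 - 8 * b * x))"
  unfolding wronskian_def poly_diff poly_mult poly_pderiv_pform poly_pform A A' B B'
    xform_defs power_one mult_1_right
  by Groebner_Basis.algebra

lemma double_affine:
  assumes "on_curve a b (Affine x y)" "y \<noteq> 0"
  obtains x3 y3 where "Affine x y \<boxplus> Affine x y = Affine x3 y3"
    "16 * y ^ 4 * y3 = y * (cubic x * (8 * x * (3 * x\<^sup>2 + a) - 16 * cubic x)
        - 2 * (3 * x\<^sup>2 + a) * ((x\<^sup>2 - a)\<^sup>2 - 8 * b * x))"
proof -
  define s where "s = (3 * x\<^sup>2 + a) / (2 * y)"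
  have s: "s * (2 * y) = 3 * x\<^sup>2 + a" using assms(2) two_neq_0 by (simp add: s_def)
  have y: "y\<^sup>2 = cubic x" using assms(1) by simp
  have "16 * y ^ 4 * (s * (x - (s\<^sup>2 - x - x)) - y)
      = y * (y\<^sup>2 * (24 * x * (s * (2 * y)) - 16 * y\<^sup>2) - 2 * (s * (2 * y)) * (s * (2 * y))\<^sup>2)"
    by Groebner_Basis.algebra
  also have "\<dots> = y * (cubic x * (8 * x * (3 * x\<^sup>2 + a) - 16 * cubic x)
        - 2 * (3 * x\<^sup>2 + a) * ((x\<^sup>2 - a)\<^sup>2 - 8 * b * x))"
    unfolding s y by Groebner_Basis.algebra
  finally show ?thesis using that[OF add_tangent[OF assms(2) s]] by blast
qed

end

section \<open>The differential equation for the y-coordinate of a multiple\<close>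

context weierstrass_closed begin

lemma mult_eq_Infinity_iff:
  assumes "on_curve a b (Affine x y)"
  shows "point_mult n (Affine x y) = Infinity \<longleftrightarrow> poly (den n) x = 0"
  using mult_poly_correct[OF assms, of n]
  by (cases "point_mult n (Affine x y)") auto

text \<open>The product \<open>V * D\<close> is the square of \<open>A - x B\<close>, so a root of
  \<open>V\<close> that is not a root of \<open>D\<close> is multiple. A common root would make
  \<open>k P\<close> and \<open>(k + 2) P\<close> infinite, hence also \<open>2 P\<close>, which
  \<open>y \<noteq> 0\<close> excludes.\<close>

lemma den_double_root:
  assumes on: "on_curve a b (Affine x y)" and y: "y \<noteq> 0" and 0: "poly (den n) x = 0"
  shows "poly (pderiv (den n)) x = 0"
proof -
  consider "n = 0" | "n = 1" | k where "n = Suc (Suc k)"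
    by (metis One_nat_def not0_implies_Suc)
  then show ?thesis
  proof cases
    case (3 k)
    define A B D V where "A = num (Suc k)" and "B = den (Suc k)" and "D = den k" and "V = den n"
    have VD: "V * D = pform_den A B"
      using mult_poly_recurrence(2)[of k] by (simp only: 3 A_def B_def D_def V_def)
    have V0: "poly V x = 0" using 0 by (simp add: V_def)
    have "poly (V * D) x = 0" using V0 by simp
    then have AB: "poly A x - x * poly B x = 0" unfolding VD by (simp add: xform_den_def)
    have "poly D x \<noteq> 0"
    proof
      assume "poly D x = 0"
      then have "point_mult k (Affine x y) = Infinity"
        using mult_eq_Infinity_iff[OF on] by (simp add: D_def)
      then have "point_mult n (Affine x y) = Affine x y \<boxplus> Affine x y" unfolding 3 by simp
      then show False
        using mult_eq_Infinity_iff[OF on, of n] 0 double_affine[OF on y] by force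
    qed
    moreover have "poly (pderiv (V * D)) x = 0" unfolding VD poly_pderiv_pform AB by simp
    then have "poly (pderiv V) x * poly D x = 0" using V0 by (auto simp: pderiv_mult)
    ultimately show ?thesis by (simp add: V_def)
  qed (use 0 in auto)
qed

text \<open>In the generic case the sum \<open>x((k + 2) P) + x(k P)\<close> is differentiated. The
  other cases, with \<open>k P\<close> or \<open>(k + 1) P\<close> infinite, are local computations
  at a zero of \<open>D\<close> or \<open>B\<close>.\<close>

lemma mult_y_step:
  assumes on: "on_curve a b (Affine x y)" and y: "y \<noteq> 0"
    and IH0: "\<And>x' y'. point_mult k (Affine x y) = Affine x' y' \<Longrightarrow>
      of_nat k * y' * (poly (den k) x)\<^sup>2 = y * poly (wronskian (num k) (den k)) x"
    and IH1: "\<And>x' y'. point_mult (Suc k) (Affine x y) = Affine x' y' \<Longrightarrow>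
      of_nat (Suc k) * y' * (poly (den (Suc k)) x)\<^sup>2
        = y * poly (wronskian (num (Suc k)) (den (Suc k))) x"
    and P: "point_mult (Suc (Suc k)) (Affine x y) = Affine x3 y3"
  shows "of_nat (Suc (Suc k)) * y3 * (poly (den (Suc (Suc k))) x)\<^sup>2
    = y * poly (wronskian (num (Suc (Suc k))) (den (Suc (Suc k)))) x"
proof -
  define A B C D U V where "A = num (Suc k)" and "B = den (Suc k)" and "C = num k" and "D = den k"
    and "U = num (Suc (Suc k))" and "V = den (Suc (Suc k))"
  note defs = A_def B_def C_def D_def U_def V_def
  define n :: 'f where "n = of_nat k"
  have n: "of_nat (Suc k) = n + 1" "of_nat (Suc (Suc k)) = n + 2" by (simp_all add: n_def)
  note R = mult_poly_recurrence[of k, folded defs]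
  have WS: "poly (wronskian U V) x * (poly D x)\<^sup>2 + poly (wronskian C D) x * (poly V x)\<^sup>2
      = poly (wronskian (pform_mid A B) (pform_den A B)) x"
    unfolding wronskian_sum[OF R(3,2), symmetric] by simp
  have WD: "poly (pderiv F) x * poly G x = poly (wronskian F G) x + poly F x * poly (pderiv G) x"
    for F G unfolding wronskian_def by simp
  have inf: "poly D x = 0 \<longleftrightarrow> point_mult k (Affine x y) = Infinity"
    "poly B x = 0 \<longleftrightarrow> point_mult (Suc k) (Affine x y) = Infinity"
    using mult_eq_Infinity_iff[OF on] by (simp_all only: defs)
  have V0: "poly V x \<noteq> 0" using mult_eq_Infinity_iff[OF on, of "Suc (Suc k)"] P by (simp add: V_def)
  have sub: "point_mult (Suc k) (Affine x y) \<boxplus> Affine x (- y) = point_mult k (Affine x y)"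
    using mult_Suc_sub[OF on, of k] by simp
  have P': "point_mult (Suc k) (Affine x y) \<boxplus> Affine x y = Affine x3 y3" using P by simp
  consider (D) "poly D x = 0" | (B) "poly B x = 0" "poly D x \<noteq> 0" | (generic) "poly B x \<noteq> 0" "poly D x \<noteq> 0"
    by blast
  then have "(n + 2) * y3 * (poly V x)\<^sup>2 = y * poly (wronskian U V) x"
  proof cases
    \<comment> \<open>Here \<open>(k + 1) P = P\<close>, and the induction hypothesis gives
      \<open>A / B\<close> the derivative \<open>k + 1\<close> at \<open>x\<close>.\<close>
    case D
    then have k1: "point_mult (Suc k) (Affine x y) = Affine x y" using inf by simp
    then have B0: "poly B x \<noteq> 0" using inf by simp
    have "(n + 1) * y * (poly B x)\<^sup>2 = y * poly (wronskian A B) x"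
      using IH1[OF k1] unfolding defs n .
    then have W1: "poly (wronskian A B) x = (n + 1) * (poly B x)\<^sup>2" using y by simp
    have A: "poly A x = x * poly B x"
      using mult_poly_correct[OF on, of "Suc k"] unfolding k1 by (simp add: defs)
    have "poly (pderiv A) x * poly B x = ((n + 1) * poly B x + x * poly (pderiv B) x) * poly B x"
      unfolding WD W1 A by Groebner_Basis.algebra
    then have A': "poly (pderiv A) x = (n + 1) * poly B x + x * poly (pderiv B) x" using B0 by simp
    have D': "poly (pderiv D) x = 0" using den_double_root[OF on y] D by (simp add: D_def)
    \<comment> \<open>The difference between \<open>C * V\<close> and \<open>pform_mid A B\<close>
      is \<open>U * D\<close>, and \<open>D\<close> vanishes to second order at \<open>x\<close>; so
      values and first derivatives agree there.\<close>
    define M where "M = C * V"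
    have M: "poly M x = poly (pform_mid A B) x" "poly (pderiv M) x = poly (pderiv (pform_mid A B)) x"
      unfolding M_def R(3)[symmetric] using D D' by (simp_all add: pderiv_mult pderiv_add)
    have "poly (wronskian U V) x * (poly C x)\<^sup>2 = poly (wronskian (U * C) M) x"
      unfolding wronskian_ratio[OF M_def[symmetric] refl, symmetric] by simp
    also have "\<dots> = poly (wronskian (pform_num A B) (pform_mid A B)) x"
      unfolding R(1) wronskian_def using M by simp
    finally have WC: "poly (wronskian U V) x * (poly C x)\<^sup>2 = (n + 1 + 1) * (poly B x) ^ 4 *
      (cubic x * (8 * x * (3 * x\<^sup>2 + a) - 16 * cubic x)
        - 2 * (3 * x\<^sup>2 + a) * ((x\<^sup>2 - a)\<^sup>2 - 8 * b * x))"
      unfolding wronskian_pform_diag[OF A A' refl refl] .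
    have "poly C x * poly V x = 4 * cubic x * (poly B x)\<^sup>2"
      using M(1) unfolding M_def poly_mult poly_pform A xform_mid_def by Groebner_Basis.algebra
    then have CV: "poly C x * poly V x = 4 * y\<^sup>2 * (poly B x)\<^sup>2" using on by simp
    have "poly C x \<noteq> 0"
      using mult_poly_correct[OF on, of k] D inf by (simp add: defs)
    obtain x3' y3' where "Affine x y \<boxplus> Affine x y = Affine x3' y3'" and
      y3': "16 * y ^ 4 * y3' = y * (cubic x * (8 * x * (3 * x\<^sup>2 + a) - 16 * cubic x)
        - 2 * (3 * x\<^sup>2 + a) * ((x\<^sup>2 - a)\<^sup>2 - 8 * b * x))"
      by (rule double_affine[OF on y])
    then have [simp]: "y3' = y3" using P' k1 by simp
    have "((n + 2) * y3 * (poly V x)\<^sup>2) * (poly C x)\<^sup>2 = (n + 2) * y3 * (poly C x * poly V x)\<^sup>2"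
      by Groebner_Basis.algebra
    also have "\<dots> = (n + 2) * (16 * y ^ 4 * y3) * (poly B x) ^ 4"
      unfolding CV by Groebner_Basis.algebra
    also have "\<dots> = y * (poly (wronskian U V) x * (poly C x)\<^sup>2)"
      unfolding y3'[simplified] WC by Groebner_Basis.algebra
    finally show ?thesis using \<open>poly C x \<noteq> 0\<close> by (simp add: mult.assoc)
  next
    \<comment> \<open>Here \<open>k P = -P\<close> and \<open>(k + 2) P = P\<close>. As
      \<open>B\<close> vanishes to second order, the sum of the roots has derivative 2 at
      \<open>x\<close>.\<close>
    case B
    then have k1: "point_mult (Suc k) (Affine x y) = Infinity" using inf by simp
    then have k0: "point_mult k (Affine x y) = Affine x (- y)" using sub by simp
    have y3: "y3 = y" using P' k1 by simp
    have "y * poly (wronskian C D) x = y * (- n * (poly D x)\<^sup>2)"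
      using IH0[OF k0] unfolding defs n_def by (simp add: ac_simps)
    then have W0: "poly (wronskian C D) x = - n * (poly D x)\<^sup>2" using mult_left_cancel[OF y] by blast
    have B': "poly (pderiv B) x = 0" using den_double_root[OF on y] B by (simp add: B_def)
    have VD: "poly V x * poly D x = (poly A x)\<^sup>2"
      unfolding poly_mult[symmetric] R(2) using B by (simp add: xform_den_def)
    have "poly (wronskian (pform_mid A B) (pform_den A B)) x = 2 * ((poly A x)\<^sup>2)\<^sup>2"
      unfolding wronskian_def poly_diff poly_mult poly_pderiv_pform poly_pform B(1) B' xform_defs
        mult_zero_right add_0_right diff_0_right zero_power2
      by Groebner_Basis.algebra
    with WS have "poly (wronskian U V) x * (poly D x)\<^sup>2 + - n * (poly D x)\<^sup>2 * (poly V x)\<^sup>2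
        = 2 * (poly V x * poly D x)\<^sup>2"
      unfolding W0 VD[symmetric] by (simp only:)
    then have "poly (wronskian U V) x * (poly D x)\<^sup>2
        = (n + 2) * (poly V x)\<^sup>2 * (poly D x)\<^sup>2"
      by Groebner_Basis.algebra
    then have "poly (wronskian U V) x = (n + 2) * (poly V x)\<^sup>2" using B by simp
    then show ?thesis by (simp add: y3)
  next
    case generic
    then obtain x1 y1 x4 y4 where k1: "point_mult (Suc k) (Affine x y) = Affine x1 y1"
      and k0: "point_mult k (Affine x y) = Affine x4 y4"
      using inf by (metis point.exhaust)
    have A: "poly A x = x1 * poly B x"
      using mult_poly_correct[OF on, of "Suc k"] unfolding k1 by (simp add: defs)
    define q where "q = poly (wronskian A B) x / (poly B x)\<^sup>2"
    have W1: "poly (wronskian A B) x = q * (poly B x)\<^sup>2" using generic by (simp add: q_def)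
    have "poly (pderiv A) x * poly B x = (q * poly B x + x1 * poly (pderiv B) x) * poly B x"
      unfolding WD W1 A by Groebner_Basis.algebra
    then have A': "poly (pderiv A) x = q * poly B x + x1 * poly (pderiv B) x"
      using generic by simp
    have "((n + 1) * y1) * (poly B x)\<^sup>2 = (y * q) * (poly B x)\<^sup>2"
      using IH1[OF k1, folded defs] unfolding W1 n by (simp only: mult.assoc)
    then have yq: "y * q = (n + 1) * y1" using generic by simp
    have W0: "y * poly (wronskian C D) x = n * y4 * (poly D x)\<^sup>2"
      using IH0[OF k0] unfolding defs n_def by simp
    have VD: "poly V x * poly D x = (x1 - x)\<^sup>2 * (poly B x)\<^sup>2"
      unfolding poly_mult[symmetric] R(2) poly_pform A xform_den_def by Groebner_Basis.algebra
    then have ne: "x1 \<noteq> x" using V0 generic by auto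
    have on1: "on_curve a b (Affine x1 y1)" using on_curve_mult[OF on, of "Suc k"] k1 by simp
    obtain x3' y3' x4' y4' where "Affine x1 y1 \<boxplus> Affine x y = Affine x3' y3'"
      "Affine x1 y1 \<boxplus> Affine x (- y) = Affine x4' y4'"
      and ys: "(y3' + y4') * (x1 - x) ^ 3
        = y1 * (2 * (x1 * x + a + (x1 + x) * x) * (x1 - x) - 2 * xform_mid x1 1 x)"
      "(y3' - y4') * (x1 - x) ^ 3
        = y * (2 * (x1 * x + a + (x1 + x) * x1) * (x1 - x) + 2 * xform_mid x1 1 x)"
      by (rule add_sub_affine[OF on1 on ne])
    then have [simp]: "y3' = y3" "y4' = y4" using P' sub unfolding k1 k0 by simp_all
    have "y * poly (wronskian (pform_mid A B) (pform_den A B)) x = (poly B x) ^ 4 * (x1 - x) *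
      (y * q * (2 * (x1 * x + a + (x1 + x) * x) * (x1 - x) - 2 * xform_mid x1 1 x)
       + y * (2 * (x1 * x + a + (x1 + x) * x1) * (x1 - x) + 2 * xform_mid x1 1 x))"
      unfolding wronskian_pform[OF A A' refl refl] by Groebner_Basis.algebra
    \<comment> \<open>The weights combine to
      \<open>(n + 1) (y3 + y4) + (y3 - y4) = (n + 2) y3 + n y4\<close>, and the hypothesis for
      \<open>k P\<close> accounts for the second term.\<close>
    also have "\<dots> = (poly B x) ^ 4 * (x1 - x) *
      ((n + 1) * ((y3 + y4) * (x1 - x) ^ 3) + (y3 - y4) * (x1 - x) ^ 3)"
      unfolding ys[simplified \<open>y3' = y3\<close> \<open>y4' = y4\<close>] yq by Groebner_Basis.algebra
    also have "\<dots> = (n + 2) * y3 * (poly V x * poly D x)\<^sup>2 + n * y4 * (poly V x * poly D x)\<^sup>2"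
      unfolding VD by Groebner_Basis.algebra
    also have "\<dots> = (n + 2) * y3 * (poly V x * poly D x)\<^sup>2
        + y * poly (wronskian C D) x * (poly V x)\<^sup>2"
      unfolding W0 by Groebner_Basis.algebra
    finally have "(poly D x)\<^sup>2 * (y * poly (wronskian U V) x)
        = (poly D x)\<^sup>2 * ((n + 2) * y3 * (poly V x)\<^sup>2)"
      unfolding WS[symmetric] by Groebner_Basis.algebra
    then show ?thesis using generic by simp
  qed
  then show ?thesis unfolding n by (simp only: defs)
qed

lemma mult_y:
  assumes on: "on_curve a b (Affine x y)" and P: "point_mult n (Affine x y) = Affine x' y'"
  shows "of_nat n * y' * (poly (den n) x)\<^sup>2 = y * poly (wronskian (num n) (den n)) x"
proof (cases "y = 0")
  case True
  \<comment> \<open>A point with \<open>y = 0\<close> is its own inverse, so an affine multiple of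
    it has \<open>y' = 0\<close>.\<close>
  have "point_mult n (Affine x y) \<in> {Infinity, Affine x y}"
    by (induction n) (use True in auto)
  then show ?thesis using P True by auto
next
  case False
  have "(\<forall>x' y'. point_mult n (Affine x y) = Affine x' y' \<longrightarrow>
      of_nat n * y' * (poly (den n) x)\<^sup>2 = y * poly (wronskian (num n) (den n)) x) \<and>
    (\<forall>x' y'. point_mult (Suc n) (Affine x y) = Affine x' y' \<longrightarrow>
      of_nat (Suc n) * y' * (poly (den (Suc n)) x)\<^sup>2
        = y * poly (wronskian (num (Suc n)) (den (Suc n))) x)"
  proof (induction n)
    case 0
    show ?case by (simp add: wronskian_def pderiv_pCons)
  next
    case (Suc n)
    then show ?case using mult_y_step[OF on False, of n] by blast
  qed
  then show ?thesis using P by blast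
qed

end

section \<open>Sums over the roots of a polynomial\<close>

lemma sum_mset_eq_sum_count:
  fixes R :: "'a::comm_semiring_1 multiset"
  assumes "finite S" "set_mset R \<subseteq> S"
  shows "sum_mset R = (\<Sum>x\<in>S. of_nat (count R x) * x)"
  using assms(2)
proof (induction R)
  case (add z R)
  have "(\<Sum>x\<in>S. of_nat (count (add_mset z R) x) * x)
      = (\<Sum>x\<in>S. (if x = z then z else 0) + of_nat (count R x) * x)"
    by (intro sum.cong) (auto simp: algebra_simps)
  also have "\<dots> = z + (\<Sum>x\<in>S. of_nat (count R x) * x)"
    using add.prems assms(1) by (simp add: sum.distrib)
  finally show ?case using add by simp
qed simp

lemma prod_linear_factors:
  fixes R :: "'a::idom multiset"
  defines "p \<equiv> \<Prod>x\<in>#R. [:- x, 1:]"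
  shows "Polynomial.degree p = size R" "Polynomial.coeff p (size R) = 1"
    "size R = Suc d \<Longrightarrow> Polynomial.coeff p d = - sum_mset R"
proof -
  have "Polynomial.degree p = size R \<and> Polynomial.coeff p (size R) = 1 \<and>
    (\<forall>d. size R = Suc d \<longrightarrow> Polynomial.coeff p d = - sum_mset R)"
    unfolding p_def
  proof (induction R)
    case (add z R)
    define q where "q = (\<Prod>x\<in>#R. [:- x, 1:])"
    have q: "Polynomial.degree q = size R" "Polynomial.coeff q (size R) = 1"
      "\<And>d. size R = Suc d \<Longrightarrow> Polynomial.coeff q d = - sum_mset R"
      using add.IH by (auto simp: q_def)
    have "q \<noteq> 0" using q(2) by auto
    then have "Polynomial.degree ([:- z, 1:] * q) = Suc (size R)"
      by (subst degree_mult_eq) (simp_all add: q(1))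
    moreover have "Polynomial.coeff ([:- z, 1:] * q) (Suc (size R)) = 1"
      using q by (simp add: Polynomial.coeff_eq_0)
    moreover have "Polynomial.coeff ([:- z, 1:] * q) (size R) = - (z + sum_mset R)"
      using q by (cases "size R") (auto simp: coeff_pCons)
    ultimately show ?case by (simp add: q_def)
  qed simp
  then show "Polynomial.degree p = size R" "Polynomial.coeff p (size R) = 1"
    "size R = Suc d \<Longrightarrow> Polynomial.coeff p d = - sum_mset R" by auto
qed

lemma monic_eq_prod_proots:
  fixes p :: "'a::alg_closed_field poly"
  assumes "Polynomial.lead_coeff p = 1"
  shows "p = (\<Prod>x\<in>#proots p. [:- x, 1:])" "size (proots p) = Polynomial.degree p"
proof -
  have "p \<noteq> 0" using assms by auto
  from alg_closed_imp_factorization[OF this] assms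
  obtain R where R: "size R = Polynomial.degree p" "p = (\<Prod>x\<in>#R. [:- x, 1:])" by auto
  have "proots (\<Prod>x\<in>#R. [:- x, 1:]) = R"
  proof (induction R)
    case (add z R)
    have "proots ([:- z, 1:] * (\<Prod>x\<in>#R. [:- x, 1:]))
        = proots [:- z, 1:] + proots (\<Prod>x\<in>#R. [:- x, 1:])"
      by (rule proots_mult) auto
    then show ?case using add by (simp del: mult_pCons_left)
  qed simp
  then have "proots p = R" unfolding R(2) .
  with R show "p = (\<Prod>x\<in>#proots p. [:- x, 1:])" "size (proots p) = Polynomial.degree p" by auto
qed

lemma sum_order_roots:
  fixes p :: "'a::alg_closed_field poly"
  assumes "Polynomial.degree p = Suc d" "Polynomial.coeff p (Suc d) = 1"
  shows "(\<Sum>r | poly p r = 0. of_nat (Polynomial.order r p) * r) = - Polynomial.coeff p d"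
proof -
  have "p \<noteq> 0" using assms by auto
  have l: "Polynomial.lead_coeff p = 1" using assms by simp
  have "Polynomial.coeff p d = - sum_mset (proots p)"
    using prod_linear_factors(3)[of "proots p" d] monic_eq_prod_proots[OF l] assms(1) by simp
  also have "sum_mset (proots p) = (\<Sum>r | poly p r = 0. of_nat (count (proots p) r) * r)"
    using \<open>p \<noteq> 0\<close> by (intro sum_mset_eq_sum_count) (auto intro: poly_roots_finite)
  finally show ?thesis using \<open>p \<noteq> 0\<close> by simp
qed

text \<open>Lagrange interpolation of \<open>q\<close> at the roots of \<open>p\<close>, read off in the top coefficient.\<close>

lemma sum_residues_simple_roots:
  fixes p q :: "'a::alg_closed_field poly"
  assumes p: "Polynomial.degree p = Suc d" "Polynomial.coeff p (Suc d) = 1"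
    and simple: "\<And>r. poly p r = 0 \<Longrightarrow> Polynomial.order r p = 1"
    and q: "Polynomial.degree q \<le> d"
  shows "(\<Sum>r | poly p r = 0. poly q r / poly (pderiv p) r) = Polynomial.coeff q d"
proof -
  define S where "S = {r. poly p r = 0}"
  have "p \<noteq> 0" using p by auto
  then have fin: "finite S" by (simp add: S_def poly_roots_finite)
  have l: "Polynomial.lead_coeff p = 1" using p by simp
  have "proots p = mset_set S"
    using \<open>p \<noteq> 0\<close> fin simple
    by (intro multiset_eqI) (auto simp: count_mset_set' S_def order_eq_0_iff)
  with monic_eq_prod_proots[OF l] p fin have pS: "p = (\<Prod>x\<in>S. [:- x, 1:])" and cS: "card S = Suc d"
    by (simp_all add: prod_unfold_prod_mset)
  define L where "L r = (\<Prod>x\<in>S - {r}. [:- x, 1:])" for r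
  have L: "Polynomial.degree (L r) = d" "Polynomial.coeff (L r) d = 1" if "r \<in> S" for r
    using prod_linear_factors(1,2)[of "mset_set (S - {r})"] fin cS that
    by (simp_all add: L_def prod_unfold_prod_mset)
  have pderiv: "poly (pderiv p) r = poly (L r) r" if "r \<in> S" for r
  proof -
    have "poly (L s) r = 0" if "s \<in> S" "s \<noteq> r" for s
      using that \<open>r \<in> S\<close> fin by (auto simp: L_def poly_prod)
    moreover have "poly (pderiv p) r = (\<Sum>s\<in>S. poly (L s) r)"
      unfolding pS pderiv_prod by (simp add: L_def poly_sum pderiv_pCons)
    ultimately have "poly (pderiv p) r = (\<Sum>s\<in>{r}. poly (L s) r)"
      using fin \<open>r \<in> S\<close> by (simp only:) (intro sum.mono_neutral_right, auto)
    then show ?thesis by simp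
  qed
  have nz: "poly (L r) r \<noteq> 0" if "r \<in> S" for r
    using fin by (auto simp: L_def poly_prod)
  define I where "I = (\<Sum>r\<in>S. Polynomial.smult (poly q r / poly (pderiv p) r) (L r))"
  have "q = I"
  proof (rule poly_eqI_degree)
    fix s assume s: "s \<in> S"
    have "poly I s = (\<Sum>r\<in>{s}. poly q r / poly (pderiv p) r * poly (L r) s)"
      unfolding I_def poly_sum poly_smult
    proof (intro sum.mono_neutral_right ballI)
      fix r assume "r \<in> S - {s}"
      then show "poly q r / poly (pderiv p) r * poly (L r) s = 0"
        using s fin by (auto simp: L_def poly_prod)
    qed (use s fin in auto)
    then show "poly q s = poly I s" using pderiv[OF s] nz[OF s] by simp
  next
    show "Polynomial.degree q < card S" using q cS by simp
    have "Polynomial.degree I \<le> d" unfolding I_def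
      using fin L by (intro degree_sum_le) (auto intro: order.trans[OF degree_smult_le])
    then show "Polynomial.degree I < card S" using cS by simp
  qed
  then have "Polynomial.coeff q d = Polynomial.coeff I d" by simp
  also have "\<dots> = (\<Sum>r\<in>S. poly q r / poly (pderiv p) r)"
    unfolding I_def Polynomial.coeff_sum using L by simp
  finally show ?thesis by (simp add: S_def)
qed

section \<open>Sums over the fibre of multiplication by n\<close>

lemma order_eq_1I:
  fixes p :: "'a::idom poly"
  assumes "poly p r = 0" "poly (pderiv p) r \<noteq> 0"
  shows "Polynomial.order r p = 1"
proof -
  have p: "p \<noteq> 0" using assms by auto
  have "\<not> Polynomial.order r p \<ge> 2"
  proof
    assume "Polynomial.order r p \<ge> 2"
    then have "[:- r, 1:]\<^sup>2 dvd p" by (simp add: order_divides)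
    then obtain g where g: "p = [:- r, 1:]\<^sup>2 * g" by (elim dvdE)
    have "poly (pderiv p) r = 0" unfolding g
      by (simp add: pderiv_mult power2_eq_square del: mult_pCons_left mult_pCons_right)
    with assms show False by simp
  qed
  moreover have "Polynomial.order r p \<noteq> 0" using assms(1) p by (simp add: order_eq_0_iff)
  ultimately show ?thesis by simp
qed

text \<open>Passing from \<open>p\<close> to its derivative loses at most one factor
  \<open>X - r\<close>, so both terms of the Wronskian keep all but one of them.\<close>

lemma order_wronskian_le:
  fixes p q :: "'a::field poly"
  assumes "wronskian p q \<noteq> 0" "p \<noteq> 0"
  shows "Polynomial.order r p \<le> Suc (Polynomial.order r (wronskian p q))"
proof (cases "Polynomial.order r p")
  case (Suc m)
  then obtain g where g: "p = [:- r, 1:] ^ Suc m * g" by (metis dvdE order_1)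
  have dvd: "[:- r, 1:] ^ m dvd [:- r, 1:] ^ Suc m" by (rule le_imp_power_dvd) simp
  have "[:- r, 1:] ^ m dvd pderiv p"
    unfolding g lemma_order_pderiv1
    by (intro dvd_add dvd_smult dvd_mult2[OF dvd] dvd_mult[OF dvd_refl])
  moreover have "[:- r, 1:] ^ m dvd p" unfolding g by (rule dvd_mult2[OF dvd])
  ultimately have "[:- r, 1:] ^ m dvd wronskian p q"
    unfolding wronskian_def by (intro dvd_diff dvd_mult2)
  then show ?thesis using assms(1) Suc by (simp add: order_divides)
qed simp

context weierstrass_closed begin

lemma order_cubic:
  assumes "cubic r = 0"
  shows "Polynomial.order r [:b, a, 0, 1:] = 1"
proof (rule order_eq_1I)
  show "poly [:b, a, 0, 1:] r = 0" using assms by (simp add: algebra_simps power3_eq_cube)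
  have "poly (pderiv [:b, a, 0, 1:]) r = 3 * r\<^sup>2 + a"
    by (simp add: pderiv_pCons algebra_simps power2_eq_square)
  then show "poly (pderiv [:b, a, 0, 1:]) r \<noteq> 0" using smooth[OF assms] by simp
qed

lemma square_roots_cubic:
  "finite {y. y\<^sup>2 = cubic r}" "card {y. y\<^sup>2 = cubic r} = (if cubic r = 0 then 1 else 2)"
proof -
  obtain z where z: "z\<^sup>2 = cubic r" using point_over[of r] by auto
  have "{y. y\<^sup>2 = cubic r} = {z, - z}" unfolding z[symmetric] power2_eq_iff by auto
  moreover have "z = - z \<longleftrightarrow> cubic r = 0"
    using neg_eq_self_iff[of z] z by (metis zero_eq_power2)
  ultimately show "finite {y. y\<^sup>2 = cubic r}"
    "card {y. y\<^sup>2 = cubic r} = (if cubic r = 0 then 1 else 2)" by auto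
qed

end

section \<open>The fibre polynomial and the preimages of Q\<close>

locale division_points = weierstrass_closed a b for a b :: "'f::alg_closed_field" +
  fixes n :: nat and xQ yQ :: 'f
  assumes n_neq_0: "of_nat n \<noteq> (0 :: 'f)" and on_curve_Q: "yQ\<^sup>2 = cubic xQ"
begin

definition preimages where
  "preimages = {P. on_curve a b P \<and> point_mult n P = Affine xQ yQ}"

definition fibre_poly where "fibre_poly = num n - [:xQ:] * den n"

abbreviation "W \<equiv> wronskian (num n) (den n)"

lemma n_Suc: obtains k where "n = Suc k" using n_neq_0 by (cases n) auto

lemma fibre_poly_top:
  obtains d where "Polynomial.degree fibre_poly = Suc d" "Polynomial.coeff fibre_poly (Suc d) = 1"
    "Polynomial.coeff fibre_poly d = - xQ * (of_nat n)\<^sup>2"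
    "Polynomial.degree (den n) \<le> d" "Polynomial.coeff (den n) d = (of_nat n)\<^sup>2"
proof -
  obtain k where k: "n = Suc k" by (rule n_Suc)
  define d where "d = k * (k + 2)"
  have A: "monic_depressed d (num n)" and B: "Polynomial.degree (den n) \<le> d"
    "Polynomial.coeff (den n) d = (of_nat n)\<^sup>2"
    using mult_poly_top[of k] unfolding mult_poly_top_def d_def k by auto
  have B': "Polynomial.coeff (den n) (Suc d) = 0" using B by (simp add: Polynomial.coeff_eq_0)
  have c: "Polynomial.coeff fibre_poly (Suc d) = 1"
    "Polynomial.coeff fibre_poly d = - xQ * (of_nat n)\<^sup>2"
    using A B B' by (simp_all add: fibre_poly_def monic_depressed_def)
  have "Polynomial.degree fibre_poly \<le> Suc d"
    unfolding fibre_poly_def using A B degree_smult_le[of xQ "den n"]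
    by (intro degree_diff_le) (auto simp: monic_depressed_def)
  moreover have "Polynomial.degree fibre_poly \<ge> Suc d" using c by (intro le_degree) simp
  ultimately show ?thesis using that c B by (meson le_antisym)
qed

lemma fibre_poly_neq_0: "fibre_poly \<noteq> 0"
  by (rule fibre_poly_top) auto

lemma finite_roots: "finite {r. poly fibre_poly r = 0}"
  using fibre_poly_neq_0 by (rule poly_roots_finite)

text \<open>At a root of \<open>fibre_poly\<close> a zero of \<open>den n\<close> would also be a
  zero of \<open>num n\<close>, so \<open>n P\<close> is affine with x-coordinate
  \<open>xQ\<close>.\<close>

lemma fibre_root:
  assumes on: "on_curve a b (Affine x y)" and r: "poly fibre_poly x = 0"
  obtains z where "point_mult n (Affine x y) = Affine xQ z" "z = yQ \<or> z = - yQ"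
    "of_nat n * z * (poly (den n) x)\<^sup>2 = y * poly W x" "poly (den n) x \<noteq> 0"
proof (cases "point_mult n (Affine x y)")
  case Infinity
  then show ?thesis using mult_poly_correct[OF on, of n] r by (simp add: fibre_poly_def)
next
  case (Affine x' z)
  then have d: "poly (den n) x \<noteq> 0" "x' = xQ"
    using mult_poly_correct[OF on, of n] r by (auto simp: fibre_poly_def)
  then have "on_curve a b (Affine xQ z)" using on_curve_mult[OF on, of n] Affine by simp
  then have "z = yQ \<or> z = - yQ" using same_x on_curve_Q by simp
  then show ?thesis using that[of z] mult_y[OF on Affine] Affine d by simp
qed

lemma den_neq_0: "poly fibre_poly x = 0 \<Longrightarrow> poly (den n) x \<noteq> 0"
  by (metis point_over fibre_root)

lemma point_mult_Infinity: "point_mult m Infinity = Infinity"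
  by (induction m) auto

text \<open>Multiples of \<open>Infinity\<close> are infinite while \<open>Q\<close> is affine, so
  the unspecified coordinates of \<open>Infinity\<close> never enter the sums.\<close>

lemma preimages_cases:
  assumes "P \<in> preimages"
  obtains x y where "P = Affine x y" "on_curve a b (Affine x y)" "poly fibre_poly x = 0"
    "of_nat n * yQ * (poly (den n) x)\<^sup>2 = y * poly W x"
proof (cases P)
  case Infinity
  then show ?thesis using assms by (simp add: preimages_def point_mult_Infinity)
next
  case (Affine x y)
  then have *: "on_curve a b (Affine x y)" "point_mult n (Affine x y) = Affine xQ yQ"
    using assms by (auto simp: preimages_def)
  then show ?thesis
    using that[OF Affine *(1)] mult_poly_correct[OF *(1), of n] mult_y[OF *]
    by (simp add: fibre_poly_def)
qed

text \<open>The Wronskian is unchanged when \<open>xQ\<close> times \<open>den n\<close> is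
  subtracted from \<open>num n\<close>, and at a root only one of its two products is left.\<close>

lemma poly_W_root:
  assumes "poly fibre_poly r = 0"
  shows "poly W r = poly (den n) r * poly (pderiv fibre_poly) r"
  using assms by (simp add: wronskian_def fibre_poly_def pderiv_diff pderiv_smult algebra_simps)

section \<open>The case of nonzero \<open>yQ\<close>\<close>

text \<open>Over a root the differential equation reads \<open>n z B = y G'\<close> with
  \<open>z = yQ\<close> or \<open>z = - yQ\<close>. As \<open>z\<close> is nonzero, so is
  \<open>G'\<close>, and \<open>Y r\<close> is the solution for \<open>z = yQ\<close>.\<close>

lemma preimages_generic:
  assumes yQ: "yQ \<noteq> 0"
  defines "Y \<equiv> \<lambda>r. of_nat n * yQ * (poly (den n) r / poly (pderiv fibre_poly) r)"
  shows "\<And>r. poly fibre_poly r = 0 \<Longrightarrow> poly (pderiv fibre_poly) r \<noteq> 0"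
    "preimages = (\<lambda>r. Affine r (Y r)) ` {r. poly fibre_poly r = 0}"
proof -
  show nz: "poly (pderiv fibre_poly) r \<noteq> 0" if r: "poly fibre_poly r = 0" for r
  proof
    assume "poly (pderiv fibre_poly) r = 0"
    then have W: "poly W r = 0" using poly_W_root[OF r] by simp
    obtain y where on: "on_curve a b (Affine r y)" by (rule point_over)
    show False
      by (rule fibre_root[OF on r]) (use W n_neq_0 yQ in auto)
  qed
  have Y: "of_nat n * yQ * (poly (den n) r)\<^sup>2 = y * poly W r \<longleftrightarrow> y = Y r"
    if r: "poly fibre_poly r = 0" for r y
    using nz[OF r] den_neq_0[OF r] unfolding poly_W_root[OF r] Y_def
    by (auto simp: field_simps power2_eq_square)
  show "preimages = (\<lambda>r. Affine r (Y r)) ` {r. poly fibre_poly r = 0}"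
  proof (intro equalityI subsetI)
    fix P assume "P \<in> preimages"
    then show "P \<in> (\<lambda>r. Affine r (Y r)) ` {r. poly fibre_poly r = 0}"
      by (rule preimages_cases) (use Y in blast)
  next
    fix P assume "P \<in> (\<lambda>r. Affine r (Y r)) ` {r. poly fibre_poly r = 0}"
    then obtain r where r: "poly fibre_poly r = 0" and P: "P = Affine r (Y r)" by blast
    obtain y where on: "on_curve a b (Affine r y)" by (rule point_over)
    then have on': "on_curve a b (Affine r (- y))" by simp
    \<comment> \<open>If the multiple of the chosen point is \<open>-Q\<close>, the inverse point
      has ordinate \<open>Y r\<close>; so in both cases the point with ordinate \<open>Y r\<close>
      lies on the curve.\<close>
    have *: "z = yQ \<Longrightarrow> y = Y r" "z = - yQ \<Longrightarrow> - y = Y r"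
      if "of_nat n * z * (poly (den n) r)\<^sup>2 = y * poly W r" for y z
    proof -
      show "y = Y r" if "z = yQ" using Y[OF r, of y] that \<open>of_nat n * z * _ = _\<close> by simp
      show "- y = Y r" if "z = - yQ"
      proof -
        have "of_nat n * yQ * (poly (den n) r)\<^sup>2 = - (of_nat n * z * (poly (den n) r)\<^sup>2)"
          using that by simp
        then show ?thesis using Y[OF r, of "- y"] \<open>of_nat n * z * _ = _\<close> by simp
      qed
    qed
    obtain z where z: "point_mult n (Affine r y) = Affine xQ z" "z = yQ \<or> z = - yQ"
      "of_nat n * z * (poly (den n) r)\<^sup>2 = y * poly W r"
      by (rule fibre_root[OF on r])
    then have "Y r = y \<or> Y r = - y" using *[OF z(3)] by auto
    then have "on_curve a b (Affine r (Y r))" using on on' by metis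
    then obtain z where z: "point_mult n P = Affine xQ z" "z = yQ \<or> z = - yQ"
      "of_nat n * z * (poly (den n) r)\<^sup>2 = Y r * poly W r" and onP: "on_curve a b P"
      using fibre_root[OF _ r] unfolding P by metis
    have "of_nat n * yQ * (poly (den n) r)\<^sup>2 = of_nat n * z * (poly (den n) r)\<^sup>2"
      using Y[OF r, of "Y r"] z(3) by simp
    then have "z = yQ" using n_neq_0 den_neq_0[OF r] by simp
    then show "P \<in> preimages" using z onP by (simp add: preimages_def)
  qed
qed

lemma sums_generic:
  assumes "yQ \<noteq> 0"
  shows "(\<Sum>P\<in>preimages. x_coord P) = (of_nat n)\<^sup>2 * xQ"
    "(\<Sum>P\<in>preimages. y_coord P) = (of_nat n) ^ 3 * yQ"
proof -
  obtain d where d: "Polynomial.degree fibre_poly = Suc d" "Polynomial.coeff fibre_poly (Suc d) = 1"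
    "Polynomial.coeff fibre_poly d = - xQ * (of_nat n)\<^sup>2"
    "Polynomial.degree (den n) \<le> d" "Polynomial.coeff (den n) d = (of_nat n)\<^sup>2"
    by (rule fibre_poly_top)
  note gen = preimages_generic[OF assms]
  have inj: "inj_on (\<lambda>r. Affine r (f r)) S" for f :: "'f \<Rightarrow> 'f" and S by (rule inj_onI) simp
  have simple: "Polynomial.order r fibre_poly = 1" if "poly fibre_poly r = 0" for r
    using order_eq_1I[OF that gen(1)[OF that]] .
  have "(\<Sum>P\<in>preimages. x_coord P) = (\<Sum>r | poly fibre_poly r = 0. of_nat (Polynomial.order r fibre_poly) * r)"
    unfolding gen(2) by (subst sum.reindex[OF inj]) (simp add: simple)
  then show "(\<Sum>P\<in>preimages. x_coord P) = (of_nat n)\<^sup>2 * xQ"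
    using sum_order_roots[OF d(1,2)] d(3) by simp
  have "(\<Sum>P\<in>preimages. y_coord P)
      = of_nat n * yQ * (\<Sum>r | poly fibre_poly r = 0. poly (den n) r / poly (pderiv fibre_poly) r)"
    unfolding gen(2) by (subst sum.reindex[OF inj]) (simp add: sum_distrib_left)
  then show "(\<Sum>P\<in>preimages. y_coord P) = (of_nat n) ^ 3 * yQ"
    using sum_residues_simple_roots[OF d(1,2) simple d(4)] d(5)
    by (simp add: power2_eq_square power3_eq_cube)
qed

section \<open>The case \<open>yQ = 0\<close>\<close>

text \<open>The square of the differential equation, with the y-coordinates of \<open>P\<close> and
  \<open>n P\<close> eliminated by the curve equation.\<close>

lemma mult_curve_equation:
  "[:(of_nat n)\<^sup>2:] * ((num n ^ 3 + [:a:] * num n * (den n)\<^sup>2 + [:b:] * den n ^ 3) * den n)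
    = [:b, a, 0, 1:] * W\<^sup>2"
proof -
  \<comment> \<open>The additional factor \<open>den n\<close> makes the identity trivial where
    \<open>n P\<close> is infinite; it is cancelled afterwards as a nonzero polynomial.\<close>
  have "den n * ([:(of_nat n)\<^sup>2:] * ((num n ^ 3 + [:a:] * num n * (den n)\<^sup>2 + [:b:] * den n ^ 3) * den n))
    = den n * ([:b, a, 0, 1:] * W\<^sup>2)"
  proof (rule poly_eqI_everywhere)
    fix x
    obtain y where on: "on_curve a b (Affine x y)" by (rule point_over)
    define A B N where "A = poly (num n) x" and "B = poly (den n) x" and "N = (of_nat n :: 'f)"
    have "B * (N\<^sup>2 * ((A ^ 3 + a * A * B\<^sup>2 + b * B ^ 3) * B)) = B * (cubic x * (poly W x)\<^sup>2)"
    proof (cases "point_mult n (Affine x y)")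
      case Infinity
      then show ?thesis using mult_eq_Infinity_iff[OF on, of n] by (simp add: B_def)
    next
      case (Affine x' z)
      then have A: "A = x' * B" using mult_poly_correct[OF on, of n] by (simp add: A_def B_def)
      have z: "z\<^sup>2 = cubic x'" using on_curve_mult[OF on, of n] Affine by simp
      have "cubic x * (poly W x)\<^sup>2 = (y * poly W x)\<^sup>2" using on by (simp add: power_mult_distrib)
      also have "\<dots> = (N * z * B\<^sup>2)\<^sup>2" using mult_y[OF on Affine] by (simp add: N_def B_def)
      also have "\<dots> = N\<^sup>2 * (z\<^sup>2 * B ^ 4)" by Groebner_Basis.algebra
      also have "\<dots> = N\<^sup>2 * ((A ^ 3 + a * A * B\<^sup>2 + b * B ^ 3) * B)"
        unfolding z A by Groebner_Basis.algebra
      finally show ?thesis by simp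
    qed
    moreover have "poly [:b, a, 0, 1:] x = cubic x" by (simp add: algebra_simps power3_eq_cube)
    ultimately show "poly (den n * ([:(of_nat n)\<^sup>2:] * ((num n ^ 3 + [:a:] * num n * (den n)\<^sup>2
        + [:b:] * den n ^ 3) * den n))) x = poly (den n * ([:b, a, 0, 1:] * W\<^sup>2)) x"
      by (simp only: poly_mult poly_add poly_power A_def B_def N_def) simp
  qed
  moreover have "den n \<noteq> 0"
  proof -
    have "fibre_poly \<noteq> 0" by (rule fibre_poly_neq_0)
    obtain d where "Polynomial.degree fibre_poly = Suc d" using fibre_poly_top by metis
    then obtain z where "poly fibre_poly z = 0"
      using alg_closed_imp_poly_has_root[of fibre_poly] by auto
    then show ?thesis using den_neq_0[of z] by auto
  qed
  ultimately show ?thesis by (simp only: mult_left_cancel not_False_eq_True)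
qed

text \<open>Since \<open>xQ\<close> is a simple root of the cubic, \<open>fibre_poly\<close> splits
  off from the left side of \<open>mult_curve_equation\<close> with a cofactor \<open>H\<close>
  nonzero at \<open>r\<close>. With \<open>w\<close> the order of \<open>W\<close>, this gives the
  order of \<open>fibre_poly\<close> as that of the cubic plus \<open>2 w\<close>, while
  \<open>order_wronskian_le\<close> bounds it by \<open>w + 1\<close>. Hence it is 1 over a root of
  the cubic and 2 elsewhere.\<close>

lemma order_fibre_poly_torsion:
  assumes yQ: "yQ = 0" and r: "poly fibre_poly r = 0"
  shows "Polynomial.order r fibre_poly = card {y. y\<^sup>2 = cubic r}"
proof -
  define A B where "A = num n" and "B = den n"
  define H where "H = A\<^sup>2 + [:xQ:] * A * B + [:xQ\<^sup>2 + a:] * B\<^sup>2"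
  have xQ: "cubic xQ = 0" using on_curve_Q yQ by simp
  then have b: "b = - (xQ ^ 3) - a * xQ" by (simp add: algebra_simps eq_neg_iff_add_eq_0)
  have GH: "A ^ 3 + [:a:] * A * B\<^sup>2 + [:b:] * B ^ 3 = fibre_poly * H"
  proof (rule poly_eqI_everywhere)
    fix x
    show "poly (A ^ 3 + [:a:] * A * B\<^sup>2 + [:b:] * B ^ 3) x = poly (fibre_poly * H) x"
      unfolding fibre_poly_def A_def[symmetric] B_def[symmetric] H_def
      by (simp add: b power2_eq_square power3_eq_cube algebra_simps)
  qed
  have B0: "poly B r \<noteq> 0" using den_neq_0[OF r] by (simp add: B_def)
  have "poly A r = xQ * poly B r" using r by (simp add: fibre_poly_def A_def B_def)
  then have "poly H r = (3 * xQ\<^sup>2 + a) * (poly B r)\<^sup>2"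
    unfolding H_def by (simp add: power2_eq_square algebra_simps)
  then have H0: "poly H r \<noteq> 0" using smooth[OF xQ] B0 by simp
  have nz: "B \<noteq> 0" "H \<noteq> 0" using B0 H0 by auto
  have eq: "Polynomial.smult ((of_nat n)\<^sup>2) (fibre_poly * H * B) = [:b, a, 0, 1:] * W\<^sup>2"
    using mult_curve_equation unfolding A_def[symmetric] B_def[symmetric] GH by simp
  have "Polynomial.smult ((of_nat n)\<^sup>2) (fibre_poly * H * B) \<noteq> 0"
    using nz fibre_poly_neq_0 n_neq_0 by simp
  then have W0: "W \<noteq> 0" and fW: "[:b, a, 0, 1:] * W\<^sup>2 \<noteq> 0" unfolding eq by auto
  have "Polynomial.order r (Polynomial.smult ((of_nat n)\<^sup>2) (fibre_poly * H * B))
      = Polynomial.order r fibre_poly"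
    using nz fibre_poly_neq_0 n_neq_0 B0 H0 by (simp add: order_smult order_mult order_0I)
  moreover have "Polynomial.order r ([:b, a, 0, 1:] * W\<^sup>2)
      = Polynomial.order r [:b, a, 0, 1:] + 2 * Polynomial.order r W"
    using fW W0 by (subst order_mult) (auto simp: power2_eq_square order_mult)
  ultimately have o: "Polynomial.order r fibre_poly
      = Polynomial.order r [:b, a, 0, 1:] + 2 * Polynomial.order r W"
    using eq by simp
  have "W = wronskian fibre_poly (den n)"
    by (simp add: wronskian_def fibre_poly_def pderiv_diff pderiv_smult algebra_simps)
  then have le: "Polynomial.order r fibre_poly \<le> Suc (Polynomial.order r W)"
    using order_wronskian_le[of fibre_poly "den n" r] W0 fibre_poly_neq_0 by simp
  have pos: "Polynomial.order r fibre_poly \<noteq> 0" using r fibre_poly_neq_0 by (simp add: order_eq_0_iff)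
  show ?thesis
  proof (cases "cubic r = 0")
    case True
    then show ?thesis using o le order_cubic[OF True] square_roots_cubic(2)[of r] by simp
  next
    case False
    then have "poly [:b, a, 0, 1:] r \<noteq> 0" by (simp add: algebra_simps power3_eq_cube)
    then have "Polynomial.order r [:b, a, 0, 1:] = 0" by (rule order_0I)
    then show ?thesis using o le pos False square_roots_cubic(2)[of r] by simp
  qed
qed

lemma sums_torsion:
  assumes yQ: "yQ = 0"
  shows "(\<Sum>P\<in>preimages. x_coord P) = (of_nat n)\<^sup>2 * xQ"
    "(\<Sum>P\<in>preimages. y_coord P) = (of_nat n) ^ 3 * yQ"
proof -
  obtain d where d: "Polynomial.degree fibre_poly = Suc d" "Polynomial.coeff fibre_poly (Suc d) = 1"
    "Polynomial.coeff fibre_poly d = - xQ * (of_nat n)\<^sup>2"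
    by (rule fibre_poly_top)
  define S where "S = (SIGMA r : {r. poly fibre_poly r = 0}. {y. y\<^sup>2 = cubic r})"
  have inj: "inj_on (\<lambda>(r, y). Affine r y) S" by (auto intro: inj_onI)
  have pre: "preimages = (\<lambda>(r, y). Affine r y) ` S"
  proof (intro equalityI subsetI)
    fix P assume "P \<in> preimages"
    then show "P \<in> (\<lambda>(r, y). Affine r y) ` S"
      by (rule preimages_cases) (force simp: S_def)
  next
    fix P assume "P \<in> (\<lambda>(r, y). Affine r y) ` S"
    then obtain r y where P: "P = Affine r y" and r: "poly fibre_poly r = 0"
      and on: "on_curve a b (Affine r y)" by (auto simp: S_def)
    obtain z where "point_mult n (Affine r y) = Affine xQ z" "z = yQ \<or> z = - yQ"
      by (rule fibre_root[OF on r])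
    moreover from this(2) have "z = yQ" using yQ by auto
    ultimately show "P \<in> preimages" unfolding preimages_def P using on by simp
  qed
  have "(\<Sum>P\<in>preimages. x_coord P) = (\<Sum>(r, y)\<in>S. r)"
    unfolding pre by (subst sum.reindex[OF inj]) (simp add: case_prod_unfold)
  also have "\<dots> = (\<Sum>r | poly fibre_poly r = 0. of_nat (card {y. y\<^sup>2 = cubic r}) * r)"
    unfolding S_def using finite_roots square_roots_cubic(1) by (subst sum.Sigma[symmetric]) auto
  also have "\<dots> = (\<Sum>r | poly fibre_poly r = 0. of_nat (Polynomial.order r fibre_poly) * r)"
    by (intro sum.cong) (simp_all add: order_fibre_poly_torsion[OF yQ])
  finally show "(\<Sum>P\<in>preimages. x_coord P) = (of_nat n)\<^sup>2 * xQ"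
    using sum_order_roots[OF d(1,2)] d(3) by simp
  \<comment> \<open>The inversion permutes \<open>S\<close>, so the sum equals its negative and
    vanishes because \<open>2 \<noteq> 0\<close>.\<close>
  have "(\<Sum>(r, y)\<in>S. y) = (\<Sum>(r, y)\<in>S. - y)"
    by (rule sum.reindex_bij_witness[of _ "\<lambda>(r, y). (r, - y)" "\<lambda>(r, y). (r, - y)"])
      (auto simp: S_def)
  also have "\<dots> = - (\<Sum>(r, y)\<in>S. y)"
    by (simp add: case_prod_unfold sum_negf)
  finally have "(\<Sum>(r, y)\<in>S. y) = 0" using neg_eq_self_iff by metis
  moreover have "(\<Sum>P\<in>preimages. y_coord P) = (\<Sum>(r, y)\<in>S. y)"
    unfolding pre by (subst sum.reindex[OF inj]) (simp add: case_prod_unfold)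
  ultimately show "(\<Sum>P\<in>preimages. y_coord P) = (of_nat n) ^ 3 * yQ"
    using yQ by (metis mult_zero_right)
qed

lemma sum_preimages:
  "(\<Sum>P\<in>preimages. x_coord P) = (of_nat n)\<^sup>2 * xQ"
  "(\<Sum>P\<in>preimages. y_coord P) = (of_nat n) ^ 3 * yQ"
  using sums_generic sums_torsion by blast+

end

section \<open>Passage to the group of points over the algebraic closure\<close>

lemma (in weierstrass) point_mult_eq_pow: "P [^]\<^bsub>curve_group a b\<^esub> m = point_mult m P"
  by (induction m) (simp_all add: curve_group_def)

theorem theorem1:
  fixes a b :: "'k::field" and n :: nat and Q :: "'k alg_closure point"
  defines "E \<equiv> curve_group (to_ac a) (to_ac b)"
  defines "\<Lambda> \<equiv> {P \<in> carrier E. P [^]\<^bsub>E\<^esub> n = Q}"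
  assumes "CHAR('k) \<noteq> 2" and "CHAR('k) \<noteq> 3"
    and "n > 0"
    and "CHAR('k) = 0 \<or> gcd (CHAR('k)) n = 1"
    and "4 * a ^ 3 + 27 * b\<^sup>2 \<noteq> 0"
    and "Q \<in> carrier E" and "Q \<noteq> \<one>\<^bsub>E\<^esub>"
  shows "1 / (of_nat n)\<^sup>2 * (\<Sum>P\<in>\<Lambda>. x_coord P) = x_coord Q \<and>
         1 / (of_nat n)\<^sup>2 * (\<Sum>P\<in>\<Lambda>. y_coord P) = of_nat n * y_coord Q"
proof -
  have prime: "CHAR('k) = 0 \<or> prime CHAR('k)" using prime_CHAR_semidom by blast
  have "\<not> CHAR('k) dvd 2"
    using assms(3) prime by (metis primes_dvd_imp_eq two_is_prime_nat dvd_0_left_iff numeral_neq_zero)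
  then have two: "(2 :: 'k alg_closure) \<noteq> 0"
    using of_nat_eq_0_iff_char_dvd[of 2, where ?'a = "'k alg_closure"] by simp
  have "\<not> CHAR('k) dvd n"
    using assms(5,6) prime by (metis dvd_0_left_iff gcd_nat.absorb1 not_prime_1 not_gr_zero)
  then have n: "of_nat n \<noteq> (0 :: 'k alg_closure)" by (simp add: of_nat_eq_0_iff_char_dvd)
  have "to_ac (4 * a ^ 3 + 27 * b\<^sup>2) \<noteq> 0" using assms(7) to_ac_eq_0_iff by blast
  then have disc: "4 * to_ac a ^ 3 + 27 * (to_ac b)\<^sup>2 \<noteq> 0"
    unfolding to_ac_add to_ac_mult to_ac_power to_ac_numeral .
  obtain xQ yQ where Q: "Q = Affine xQ yQ" and on: "yQ\<^sup>2 = xQ ^ 3 + to_ac a * xQ + to_ac b"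
    using assms(8,9) by (cases Q) (auto simp: E_def curve_group_def on_curve_def)
  interpret division_points "to_ac a" "to_ac b" n xQ yQ
    by unfold_locales (use two disc n on in auto)
  have "\<Lambda> = preimages"
    unfolding \<Lambda>_def E_def preimages_def point_mult_eq_pow Q by (simp add: curve_group_def)
  moreover have "1 / (of_nat n)\<^sup>2 * ((of_nat n)\<^sup>2 * xQ) = xQ" using n by simp
  moreover have "1 / (of_nat n)\<^sup>2 * ((of_nat n) ^ 3 * yQ) = of_nat n * yQ"
    using n by (simp add: power2_eq_square power3_eq_cube)
  ultimately show ?thesis unfolding Q point.sel by (simp only: sum_preimages)
qed

end
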